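(* Let $h>0$ and let $\beta>0$ satisfy $\beta<\beta_0$, where $\beta_0>0$ is the constant determined by $16\cdot 2^{1/2}\beta_0 e^{16\beta_0^2}=1$. For $t\in[0,1]$ let $$Y_N(t)=N^{1/2}\Big(\frac1N\log Z_N(t)-\log 2-\frac{\beta^2 t(1-q)^2}{4}-\mathbf{E}\big[\log\cosh(\beta q^{1/2}Y+h)\big]\Big),$$ where $Y$ is a standard Gaussian random variable and $Z_N(t)$, $q$ are as defined in the context. Then, as $N\to\infty$, $Y_N(1)$ converges in distribution to a centered Gaussian random variable with variance $$\tau^2=\nu^2-\frac{\beta^2q^2}{2},\qquad \nu^2=\operatorname{Var}\big(\log\cosh(\beta q^{1/2}Y+h)\big).$$
   Context: For $N\ge1$ let $\Sigma_N=\{-1,1\}^N$, with elements $\sigma=(\sigma_1,\dots,\sigma_N)$. On a complete stochastic basis $(\Omega,\mathcal{F},(\mathcal{F}_t)_{t\in[0,1]},P)$ let $\{B_{i,j};1\le i<j\}$ and $\{W_i;i\ge1\}$ be independent standard $\mathcal{F}_t$-Brownian motions and let $\{\eta_i;i\ge1\}$ be independent $\mathcal{F}_0$-measurable standard Gaussian random variables. For $i\ge1$, $X_i$ is the unique solution of $$X_i(t)=\eta_i-\int_0^t\frac{X_i(s)}{1-s}\,ds+W_i(t),\qquad t\in[0,1]$$ (so that $s\mapsto X_i(1-s)$ is a Brownian motion in its own filtration, and in particular $X_i(1)=0$). The number $q\in[0,1]$ is the solution of $q=\mathbf{E}[\tanh^2(\beta q^{1/2}Y+h)]$ with $Y$ standard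 Gaussian. The interpolating Hamiltonian and the partition function are $$-H_{N,t}(\sigma)=\frac{\beta}{N^{1/2}}\sum_{1\le i<j\le N}B_{i,j}(t)\sigma_i\sigma_j+\beta q^{1/2}\sum_{i\le N}X_i(t)\sigma_i+h\sum_{i\le N}\sigma_i,\qquad Z_N(t)=\sum_{\sigma\in\Sigma_N}\exp(-H_{N,t}(\sigma)).$$ At $t=1$ this is the Sherrington–Kirkpatrick model with external field $h$ at inverse temperature $\beta$. *)

theory Defs
  imports "HOL-Probability.Probability"
begin

text \<open>
  A complete stochastic basis with time interval \<open>[0,1]\<close>: a filtered probability space under the
  usual conditions (completeness and right-continuity). \<open>F t\<close> is only constrained for
  \<open>t \<in> [0,1]\<close>.
\<close>

definition complete_stochastic_basis :: "'a measure \<Rightarrow> (real \<Rightarrow> 'a measure) \<Rightarrow> bool" where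
  "complete_stochastic_basis M F \<longleftrightarrow>
     prob_space M \<and> complete_measure M \<and>
     (\<forall>t\<in>{0..1}. subalgebra M (F t)) \<and>
     (\<forall>s\<in>{0..1}. \<forall>t\<in>{0..1}. s \<le> t \<longrightarrow> sets (F s) \<subseteq> sets (F t)) \<and>
     (\<forall>t\<in>{0..<1}. sets (F t) = (\<Inter>s\<in>{t<..1}. sets (F s))) \<and>
     null_sets M \<subseteq> sets (F 0)"

definition std_brownian_motion ::
    "'a measure \<Rightarrow> (real \<Rightarrow> 'a measure) \<Rightarrow> (real \<Rightarrow> 'a \<Rightarrow> real) \<Rightarrow> bool" where
  "std_brownian_motion M F W \<longleftrightarrow>
     (\<forall>t\<in>{0..1}. W t \<in> borel_measurable (F t)) \<and>
     (AE \<omega> in M. W 0 \<omega> = 0 \<and> continuous_on {0..1} (\<lambda>t. W t \<omega>)) \<and>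
     (\<forall>s t. 0 \<le> s \<and> s < t \<and> t \<le> 1 \<longrightarrow>
        distributed M lborel (\<lambda>\<omega>. W t \<omega> - W s \<omega>) (normal_density 0 (sqrt (t - s))) \<and>
        prob_space.indep_set M (sets (F s))
          (sets (vimage_algebra (space M) (\<lambda>\<omega>. W t \<omega> - W s \<omega>) borel)))"

text \<open>
  Mutual independence, as processes on \<open>[0,1]\<close> (random elements of the product space
  \<open>\<real>\<^bsup>[0,1]\<^esup>\<close>), of the whole collection \<open>B i j\<close> (\<open>1 \<le> i < j\<close>), \<open>W i\<close> (\<open>1 \<le> i\<close>).
\<close>

definition independent_processes ::
    "'a measure \<Rightarrow> (nat \<Rightarrow> nat \<Rightarrow> real \<Rightarrow> 'a \<Rightarrow> real) \<Rightarrow> (nat \<Rightarrow> real \<Rightarrow> 'a \<Rightarrow> real) \<Rightarrow> bool" where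
  "independent_processes M B W \<longleftrightarrow>
     prob_space.indep_vars M (\<lambda>_. \<Pi>\<^sub>M t\<in>{0..1::real}. (borel :: real measure))
       (case_sum (\<lambda>(i, j) \<omega>. \<lambda>t\<in>{0..1}. B i j t \<omega>) (\<lambda>i \<omega>. \<lambda>t\<in>{0..1}. W i t \<omega>))
       ({(i, j). 1 \<le> i \<and> i < j} <+> {1..})"

text \<open>
  Adapted continuous solutions of \<open>X(t) = \<eta> - \<integral>\<^sub>0\<^sup>t X(s) / (1 - s) ds + W(t)\<close> on the closed interval
  \<open>[0,1]\<close>. Integrability is required explicitly because the library's integral of a
  non-integrable function is 0; the value of the integrand at \<open>s = 1\<close> is immaterial.
\<close>

definition bridge_solution ::
    "'a measure \<Rightarrow> (real \<Rightarrow> 'a measure) \<Rightarrow> ('a \<Rightarrow> real) \<Rightarrow> (real \<Rightarrow> 'a \<Rightarrow> real) \<Rightarrow>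
      (real \<Rightarrow> 'a \<Rightarrow> real) \<Rightarrow> bool" where
  "bridge_solution M F \<eta> W X \<longleftrightarrow>
     (\<forall>t\<in>{0..1}. X t \<in> borel_measurable (F t)) \<and>
     (AE \<omega> in M. continuous_on {0..1} (\<lambda>t. X t \<omega>) \<and>
        (\<forall>t\<in>{0..1}.
           set_integrable lborel {0..t} (\<lambda>s. X s \<omega> / (1 - s)) \<and>
           X t \<omega> = \<eta> \<omega> - (LINT s:{0..t}|lborel. X s \<omega> / (1 - s)) + W t \<omega>))"

definition spin_configs :: "nat \<Rightarrow> (nat \<Rightarrow> real) set" where
  "spin_configs N = {1..N} \<rightarrow>\<^sub>E {-1, 1}"

definition hamiltonian ::
    "real \<Rightarrow> real \<Rightarrow> real \<Rightarrow> (nat \<Rightarrow> nat \<Rightarrow> real \<Rightarrow> 'a \<Rightarrow> real) \<Rightarrow> (nat \<Rightarrow> real \<Rightarrow> 'a \<Rightarrow> real) \<Rightarrow>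
      nat \<Rightarrow> real \<Rightarrow> (nat \<Rightarrow> real) \<Rightarrow> 'a \<Rightarrow> real" where
  "hamiltonian \<beta> h q B X N t \<sigma> \<omega> =
     - (\<beta> / sqrt (real N) * (\<Sum>(i, j)\<in>{(i, j). 1 \<le> i \<and> i < j \<and> j \<le> N}. B i j t \<omega> * \<sigma> i * \<sigma> j)
        + \<beta> * sqrt q * (\<Sum>i=1..N. X i t \<omega> * \<sigma> i)
        + h * (\<Sum>i=1..N. \<sigma> i))"

definition partition_function ::
    "real \<Rightarrow> real \<Rightarrow> real \<Rightarrow> (nat \<Rightarrow> nat \<Rightarrow> real \<Rightarrow> 'a \<Rightarrow> real) \<Rightarrow> (nat \<Rightarrow> real \<Rightarrow> 'a \<Rightarrow> real) \<Rightarrow>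
      nat \<Rightarrow> real \<Rightarrow> 'a \<Rightarrow> real" where
  "partition_function \<beta> h q B X N t \<omega> =
     (\<Sum>\<sigma>\<in>spin_configs N. exp (- hamiltonian \<beta> h q B X N t \<sigma> \<omega>))"

definition free_energy_fluctuation ::
    "real \<Rightarrow> real \<Rightarrow> real \<Rightarrow> (nat \<Rightarrow> nat \<Rightarrow> real \<Rightarrow> 'a \<Rightarrow> real) \<Rightarrow> (nat \<Rightarrow> real \<Rightarrow> 'a \<Rightarrow> real) \<Rightarrow>
      nat \<Rightarrow> real \<Rightarrow> 'a \<Rightarrow> real" where
  "free_energy_fluctuation \<beta> h q B X N t \<omega> =
     sqrt (real N) *
       (ln (partition_function \<beta> h q B X N t \<omega>) / real N - ln 2 - \<beta>\<^sup>2 * t * (1 - q)\<^sup>2 / 4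
        - (LINT y|std_normal_distribution. ln (cosh (\<beta> * sqrt q * y + h))))"

definition limit_variance :: "real \<Rightarrow> real \<Rightarrow> real \<Rightarrow> real" where
  "limit_variance \<beta> h q =
     prob_space.variance std_normal_distribution (\<lambda>y. ln (cosh (\<beta> * sqrt q * y + h)))
     - \<beta>\<^sup>2 * q\<^sup>2 / 2"

text \<open>
  The centered Gaussian law of variance \<open>v \<ge> 0\<close>. The push-forward form, unlike
  \<open>normal_density 0 (sqrt v)\<close>, is also correct for \<open>v = 0\<close>.
\<close>

definition centered_gaussian :: "real \<Rightarrow> real measure" where
  "centered_gaussian v = distr std_normal_distribution borel (\<lambda>y. sqrt v * y)"

end

theory Submission
  imports Defs "HOL-Real_Asymp.Real_Asymp"
begin

text \<open>
  Since \<open>X\<^sub>i(s) / (1 - s)\<close> is integrable up to \<open>s = 1\<close>, \<open>X\<^sub>i(1) = 0\<close> almost surely, so at time one only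
  the Sherrington-Kirkpatrick Hamiltonian with independent standard normal couplings is left. It is
  joined to a model of independent sites by a rotation: the couplings are weighted by \<open>sin t\<close>, and new
  independent Gaussian fields \<open>\<beta> \<surd>q z\<^sub>i\<close> by \<open>cos t\<close>, for \<open>0 \<le> t \<le> \<pi>/2\<close>. Gaussian integration by parts
  shows that, with \<open>u = s / \<surd>N\<close>, the derivative of \<open>E[Z\<^sub>t\<^sup>\<i>\<^sup>u]\<close> is an explicit multiple of \<open>E[Z\<^sub>t\<^sup>\<i>\<^sup>u]\<close> up
  to an error of order \<open>\<bar>u\<bar>\<close> times the Gibbs average of \<open>N (R - q)\<^sup>2\<close>, where \<open>R\<close> is the overlap of two
  replicas. This average is bounded uniformly in \<open>N\<close> because for small \<open>\<beta>\<close> an exponential moment of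
  \<open>N (R - q)\<^sup>2\<close>, with a suitably decreasing exponent, is nonincreasing in \<open>t\<close>. At \<open>t = 0\<close> the
  characteristic function is that of a sum of \<open>N\<close> independent variables \<open>log cosh (\<beta> \<surd>q z\<^sub>i + h)\<close>, which
  contributes the variance \<open>\<nu>\<^sup>2\<close>, and the explicit multiple contributes \<open>- \<beta>\<^sup>2 q\<^sup>2 / 2\<close>.
\<close>

section \<open>Gaussian integration by parts\<close>

text \<open>Imaginary powers of Z keep the whole argument inside one family: a Gibbs average times a
  complex power of Z, differentiated in time or in a Gaussian coordinate, is again of this kind with
  one more replica, and its modulus stays bounded by the observable. One formula thus yields both
  the monotone moment (exponent 2) and the derivative of the characteristic function (exponent
  -\<i>u).

  Along the rotation, couplings and fields enter the derivative with opposite signs, which completes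
  a square: only N (R - q)^2 and constants occur. In the derivative of E[Z^(\<i>u)] that square
  carries a factor of order u, so a bounded mean suffices and no limit law of the overlap is
  required. The obstacle is that differentiating the moment creates overlaps with new replicas.
  Those with negative sign are discarded; the one surviving product over two disjoint pairs is
  merged into a single pair by Chebyshev's correlation inequality, which closes the estimate without
  any a priori concentration. The fixed-point equation for q enters at t = 0, where it centers the
  overlap at q.\<close>

lemma has_vector_derivative_integral_dominated:
  fixes f f' :: "real \<Rightarrow> 'a \<Rightarrow> 'b::{banach, second_countable_topology}"
  assumes f: "\<And>t. integrable M (f t)"
    and f': "\<And>t. f' t \<in> borel_measurable M"
    and deriv: "\<And>t x. x \<in> space M \<Longrightarrow> ((\<lambda>t. f t x) has_vector_derivative f' t x) (at t)"
    and w: "integrable M w" and bound: "\<And>t x. x \<in> space M \<Longrightarrow> norm (f' t x) \<le> w x"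
  shows "((\<lambda>t. \<integral>x. f t x \<partial>M) has_vector_derivative (\<integral>x. f' t x \<partial>M)) (at t)"
proof -
  have f'_int: "integrable M (f' t)" for t
    by (rule Bochner_Integration.integrable_bound[OF w f']) (auto intro!: AE_I2 order_trans[OF bound])
  define R where "R s x = norm (f s x - f t x - (s - t) *\<^sub>R f' t x) / norm (s - t)" for s x
  have R_int: "integrable M (R s)" for s
    unfolding R_def
    by (intro integrable_divide integrable_norm Bochner_Integration.integrable_diff f
        integrable_scaleR_right f'_int)
  have R_lim: "((\<lambda>s. R s x) \<longlongrightarrow> 0) (at t)" if "x \<in> space M" for x
    using deriv[OF that, of t] unfolding has_vector_derivative_def has_derivative_iff_norm R_def by simp
  have R_bound: "norm (R s x) \<le> 2 * w x" if x: "x \<in> space M" for s x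
  proof (cases "s = t")
    \<comment> \<open>At \<open>s = t\<close> the quotient is 0 by the convention for division by
      zero, so the bound reduces to \<open>0 \<le> w x\<close>.\<close>
    case True
    have "0 \<le> w x" using bound[OF x, of t] norm_ge_zero order_trans by blast
    with True show ?thesis by (simp add: R_def)
  next
    case False
    have "norm (f s x - f t x) \<le> norm (s - t) * w x"
    proof -
      have "onorm (\<lambda>h. h *\<^sub>R f' u x) \<le> w x" for u
        by (rule onorm_le) (use bound[OF x, of u] in \<open>auto simp: mult.commute intro!: mult_left_mono\<close>)
      then show ?thesis
        using differentiable_bound[of UNIV "\<lambda>t. f t x" "\<lambda>u h. h *\<^sub>R f' u x" "w x" s t] deriv[OF x]
        by (auto simp: has_vector_derivative_def mult.commute)
    qed
    moreover have "norm ((s - t) *\<^sub>R f' t x) \<le> norm (s - t) * w x"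
      using bound[OF x, of t] by (simp add: mult_left_mono)
    ultimately have "norm (f s x - f t x - (s - t) *\<^sub>R f' t x) \<le> norm (s - t) * (2 * w x)"
      using norm_triangle_ineq4[of "f s x - f t x" "(s - t) *\<^sub>R f' t x"] by linarith
    with False show ?thesis by (simp add: R_def divide_le_eq mult.commute)
  qed
  have lim: "((\<lambda>s. \<integral>x. R s x \<partial>M) \<longlongrightarrow> 0) (at t)"
    unfolding tendsto_at_iff_sequentially
  proof (intro allI impI, unfold comp_def)
    fix X :: "nat \<Rightarrow> real" assume X: "\<forall>i. X i \<in> UNIV - {t}" "X \<longlonglongrightarrow> t"
    have "(\<lambda>i. \<integral>x. R (X i) x \<partial>M) \<longlonglongrightarrow> (\<integral>x. 0 \<partial>M)"
    proof (rule integral_dominated_convergence[where w="\<lambda>x. 2 * w x"])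
      show "AE x in M. (\<lambda>i. R (X i) x) \<longlonglongrightarrow> 0"
        using R_lim X unfolding tendsto_at_iff_sequentially comp_def by (intro AE_I2) blast
    qed (use R_int w R_bound in auto)
    then show "(\<lambda>i. \<integral>x. R (X i) x \<partial>M) \<longlonglongrightarrow> 0" by simp
  qed
  have le: "norm (norm ((\<integral>x. f s x \<partial>M) - (\<integral>x. f t x \<partial>M) - (s - t) *\<^sub>R (\<integral>x. f' t x \<partial>M)) / norm (s - t))
      \<le> (\<integral>x. R s x \<partial>M)" for s
  proof -
    have "(\<integral>x. f s x \<partial>M) - (\<integral>x. f t x \<partial>M) - (s - t) *\<^sub>R (\<integral>x. f' t x \<partial>M)
        = (\<integral>x. f s x - f t x - (s - t) *\<^sub>R f' t x \<partial>M)"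
      using f f'_int by simp
    then show ?thesis
      using integral_norm_bound[of M "\<lambda>x. f s x - f t x - (s - t) *\<^sub>R f' t x"]
      by (simp add: R_def divide_right_mono)
  qed
  have "((\<lambda>s. norm ((\<integral>x. f s x \<partial>M) - (\<integral>x. f t x \<partial>M) - (s - t) *\<^sub>R (\<integral>x. f' t x \<partial>M)) / norm (s - t))
      \<longlongrightarrow> 0) (at t)"
    by (rule Lim_null_comparison[OF always_eventually lim], rule allI, rule le)
  then show ?thesis
    unfolding has_vector_derivative_def has_derivative_iff_norm
    by (simp add: bounded_linear_scaleR_left)
qed

text \<open>The density satisfies \<phi>' = - x \<phi>, so the difference of the two integrands is
  the derivative of \<phi> F, and boundedness of F removes the boundary terms. Values are complex
  because F will contain an imaginary power of the partition function.\<close>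

lemma stein_std_normal:
  fixes F F' :: "real \<Rightarrow> complex"
  assumes deriv: "\<And>x. (F has_vector_derivative F' x) (at x)"
    and cont: "continuous_on UNIV F'"
    and F_bound: "\<And>x. norm (F x) \<le> C" and F'_bound: "\<And>x. norm (F' x) \<le> C"
  shows "(\<integral>x. of_real x * F x \<partial>std_normal_distribution) = (\<integral>x. F' x \<partial>std_normal_distribution)"
proof -
  let ?\<phi> = std_normal_density
  have contF: "continuous_on UNIV F"
    using deriv has_vector_derivative_continuous continuous_at_imp_continuous_on by blast
  have [measurable]: "F \<in> borel_measurable borel" "F' \<in> borel_measurable borel"
    using contF cont by (simp_all add: borel_measurable_continuous_onI)
  have \<phi>': "(?\<phi> has_real_derivative - x * ?\<phi> x) (at x)" for x
    unfolding std_normal_density_def by (auto intro!: derivative_eq_intros simp: field_simps)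
  have i1: "integrable lborel (\<lambda>x. ?\<phi> x *\<^sub>R F' x)"
  proof (rule Bochner_Integration.integrable_bound)
    show "integrable lborel (\<lambda>x. C * ?\<phi> x)" using integrable_std_normal_moment[of 0] by simp
    have "0 \<le> C" using F_bound[of 0] norm_ge_zero order_trans by blast
    then show "AE x in lborel. norm (?\<phi> x *\<^sub>R F' x) \<le> norm (C * ?\<phi> x)"
      using F'_bound by (intro AE_I2) (auto simp: mult.commute[of C] intro!: mult_left_mono)
  qed simp
  have i2: "integrable lborel (\<lambda>x. ?\<phi> x *\<^sub>R (of_real x * F x))"
  proof (rule Bochner_Integration.integrable_bound)
    show "integrable lborel (\<lambda>x. C * (?\<phi> x * x ^ 1))"
      using integrable_std_normal_moment[of 1] by simp
    have "0 \<le> C" using F_bound[of 0] norm_ge_zero order_trans by blast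
    then show "AE x in lborel. norm (?\<phi> x *\<^sub>R (of_real x * F x)) \<le> norm (C * (?\<phi> x * x ^ 1))"
      using mult_left_mono[OF F_bound, of "?\<phi> x * \<bar>x\<bar>" for x]
      by (intro AE_I2) (auto simp: norm_mult abs_mult mult_ac)
  qed simp
  let ?G = "\<lambda>x. ?\<phi> x *\<^sub>R F x" and ?g = "\<lambda>x. ?\<phi> x *\<^sub>R F' x - ?\<phi> x *\<^sub>R (of_real x * F x)"
  have \<phi>_lim: "(?\<phi> \<longlongrightarrow> 0) at_top" "(?\<phi> \<longlongrightarrow> 0) at_bot"
    unfolding std_normal_density_def by real_asymp+
  have lim0: "(?G \<longlongrightarrow> 0) FF" if "(?\<phi> \<longlongrightarrow> 0) FF" for FF
  proof (rule Lim_null_comparison)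
    show "eventually (\<lambda>x. norm (?G x) \<le> ?\<phi> x * C) FF"
      using F_bound by (intro always_eventually) (auto intro!: mult_left_mono)
    show "((\<lambda>x. ?\<phi> x * C) \<longlongrightarrow> 0) FF" using tendsto_mult_right[OF that, of C] by simp
  qed
  have "(LBINT x=-\<infinity>..\<infinity>. ?g x) = 0 - 0"
  proof (rule interval_integral_FTC_integrable[where F="?G"])
    fix x
    show "(?G has_vector_derivative ?g x) (at x)"
      by (rule derivative_eq_intros \<phi>' deriv refl)+ (simp add: scaleR_conv_of_real algebra_simps)
    have "isCont F x" "isCont F' x" "isCont ?\<phi> x"
      using contF cont DERIV_isCont[OF \<phi>'] by (auto simp: continuous_on_eq_continuous_at)
    then show "isCont ?g x" by (auto intro!: continuous_intros)
  next
    show "set_integrable lborel (einterval (-\<infinity>) \<infinity>) ?g"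
      using i1 i2 by (simp add: set_integrable_def)
    show "((?G \<circ> real_of_ereal) \<longlongrightarrow> 0) (at_right (-\<infinity>))" "((?G \<circ> real_of_ereal) \<longlongrightarrow> 0) (at_left \<infinity>)"
      using lim0 \<phi>_lim by (simp_all add: ereal_tendsto_simps1)
  qed simp
  then have "(\<integral>x. ?g x \<partial>lborel) = 0"
    by (simp add: interval_integral_to_infinity_eq interval_lebesgue_integral_def set_lebesgue_integral_def)
  then have "(\<integral>x. ?\<phi> x *\<^sub>R F' x \<partial>lborel) = (\<integral>x. ?\<phi> x *\<^sub>R (of_real x * F x) \<partial>lborel)"
    using i1 i2 by simp
  then show ?thesis
    by (simp add: integral_density normal_density_nonneg)
qed

section \<open>Standard Gaussian vectors and integration by parts in one coordinate\<close>

abbreviation std_gaussian :: "'k set \<Rightarrow> ('k \<Rightarrow> real) measure" where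
  "std_gaussian I \<equiv> Pi\<^sub>M I (\<lambda>_. std_normal_distribution)"

interpretation std_normal: prob_space std_normal_distribution
  by (rule prob_space_normal_density) simp

interpretation std_normal_product: product_prob_space "\<lambda>_. std_normal_distribution" I
  for I :: "'k set"
  by unfold_locales

lemma sets_std_gaussian [measurable_cong]:
  "sets (std_gaussian I) = sets (Pi\<^sub>M I (\<lambda>_. borel :: real measure))"
  by (rule sets_PiM_cong) auto

lemma prob_space_std_gaussian: "prob_space (std_gaussian I)"
  by (rule prob_space_PiM) (rule std_normal.prob_space_axioms)

lemma integrable_bounded_std_gaussian:
  fixes f :: "_ \<Rightarrow> 'b::{banach, second_countable_topology}"
  assumes "f \<in> borel_measurable (std_gaussian I)" "\<And>g. norm (f g) \<le> C"
  shows "integrable (std_gaussian I) f"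
  using finite_measure.integrable_const_bound[OF prob_space.finite_measure[OF prob_space_std_gaussian]] assms
  by (metis (mono_tags, lifting) AE_I2)

lemma distr_std_gaussian_component:
  assumes "finite I" "k \<in> I"
  shows "distr (std_gaussian I) std_normal_distribution (\<lambda>g. g k) = std_normal_distribution"
  using std_normal_product.PiM_component[of k I] assms by simp

lemma integrable_std_gaussian_component:
  assumes "finite I" "k \<in> I"
  shows "integrable (std_gaussian I) (\<lambda>g. g k)"
proof -
  have "integrable (distr (std_gaussian I) std_normal_distribution (\<lambda>g. g k)) (\<lambda>x. x ^ 1)"
    unfolding distr_std_gaussian_component[OF assms] by (rule integrable_std_normal_distribution_moment)
  from integrable_distr[OF _ this] show ?thesis
    using assms by (simp add: measurable_component_singleton)
qed

lemma stein_std_gaussian: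
  fixes F F' :: "('k \<Rightarrow> real) \<Rightarrow> complex"
  assumes I: "finite I" "k \<in> I"
    and F: "F \<in> borel_measurable (std_gaussian I)" and F': "F' \<in> borel_measurable (std_gaussian I)"
    and deriv: "\<And>g x. ((\<lambda>y. F (g(k := y))) has_vector_derivative F' (g(k := x))) (at x)"
    and cont: "\<And>g. continuous_on UNIV (\<lambda>x. F' (g(k := x)))"
    and F_bound: "\<And>g. norm (F g) \<le> C" and F'_bound: "\<And>g. norm (F' g) \<le> C"
  shows "(\<integral>g. of_real (g k) * F g \<partial>std_gaussian I) = (\<integral>g. F' g \<partial>std_gaussian I)"
proof -
  define J where "J = I - {k}"
  have J: "finite J" "k \<notin> J" and IJ: "I = insert k J" using I by (auto simp: J_def)
  have i1: "integrable (std_gaussian I) (\<lambda>g. of_real (g k) * F g)"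
  proof (rule Bochner_Integration.integrable_bound)
    show "integrable (std_gaussian I) (\<lambda>g. C * g k)"
      using integrable_std_gaussian_component[OF I] by simp
    have [measurable]: "(\<lambda>g. g k) \<in> borel_measurable (std_gaussian I)"
      using I by (simp add: measurable_component_singleton)
    show "(\<lambda>g. of_real (g k) * F g) \<in> borel_measurable (std_gaussian I)" using F by measurable
    have "0 \<le> C" using F_bound[of undefined] norm_ge_zero order_trans by blast
    then show "AE g in std_gaussian I. norm (of_real (g k) * F g) \<le> norm (C * g k)"
      using mult_left_mono[OF F_bound, of "\<bar>g k\<bar>" for g]
      by (intro AE_I2) (auto simp: norm_mult abs_mult mult_ac)
  qed
  have i2: "integrable (std_gaussian I) F'"
    by (rule integrable_bounded_std_gaussian[OF F' F'_bound])
  have "(\<integral>g. of_real (g k) * F g \<partial>std_gaussian I)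
      = (\<integral>g. (\<integral>y. of_real y * F (g(k := y)) \<partial>std_normal_distribution) \<partial>std_gaussian J)"
    unfolding IJ by (subst std_normal_product.product_integral_insert[OF J]) (use i1 IJ in simp_all)
  also have "\<dots> = (\<integral>g. (\<integral>y. F' (g(k := y)) \<partial>std_normal_distribution) \<partial>std_gaussian J)"
    by (intro Bochner_Integration.integral_cong refl stein_std_normal[where C=C] deriv cont F_bound F'_bound)
  also have "\<dots> = (\<integral>g. F' g \<partial>std_gaussian I)"
    unfolding IJ by (subst std_normal_product.product_integral_insert[OF J]) (use i2 IJ in simp_all)
  finally show ?thesis .
qed

section \<open>Gaussian interpolation of Gibbs averages\<close>

text \<open>With Z the sum over \<open>S\<close>, this is the quotient rule for G Z^(-p): the
  numerator over Z^(p+1) is a double sum in which the index \<open>s\<close> of Z or of its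
  derivative acts as one further replica. Writing the power as an exponential of ln Z admits complex
  \<open>p\<close>; the abstract variable covers both time and a Gaussian coordinate.\<close>

lemma has_vector_derivative_gibbs_quotient:
  fixes E E' :: "'r \<Rightarrow> real \<Rightarrow> real" and U U' :: "'s \<Rightarrow> real \<Rightarrow> real" and F F' :: "'r \<Rightarrow> real \<Rightarrow> complex"
  assumes fin: "finite A" "finite S" "S \<noteq> {}"
    and E: "\<And>r. r \<in> A \<Longrightarrow> (E r has_real_derivative E' r x) (at x)"
    and U: "\<And>s. s \<in> S \<Longrightarrow> (U s has_real_derivative U' s x) (at x)"
    and F: "\<And>r. r \<in> A \<Longrightarrow> (F r has_vector_derivative F' r x) (at x)"
  shows "((\<lambda>x. (\<Sum>r\<in>A. F r x * exp (of_real (E r x))) * exp (- p * of_real (ln (\<Sum>s\<in>S. exp (U s x)))))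
    has_vector_derivative
      (\<Sum>r\<in>A. F' r x * exp (of_real (E r x))) * exp (- p * of_real (ln (\<Sum>s\<in>S. exp (U s x))))
      + (\<Sum>(r, s)\<in>A \<times> S. F r x * (of_real (E' r x) - p * of_real (U' s x)) * exp (of_real (E r x + U s x)))
        * exp (- (p + 1) * of_real (ln (\<Sum>s\<in>S. exp (U s x))))) (at x)"
proof -
  define Z where "Z x = (\<Sum>s\<in>S. exp (U s x))" for x
  define Z' where "Z' = (\<Sum>s\<in>S. exp (U s x) * U' s x)"
  define Y where "Y = exp (- p * of_real (ln (Z x)))"
  define G where "G = (\<Sum>r\<in>A. F r x * exp (of_real (E r x)))"
  define G1 where "G1 = (\<Sum>r\<in>A. F' r x * exp (of_real (E r x)))"
  define G2 where "G2 = (\<Sum>r\<in>A. F r x * of_real (E' r x) * exp (of_real (E r x)))"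
  have Zpos: "Z x > 0" unfolding Z_def using fin by (intro sum_pos) auto
  have expd: "((\<lambda>x. exp (of_real (e x)) :: complex) has_vector_derivative of_real e' * exp (of_real (e x))) (at x)"
    if "(e has_real_derivative e') (at x)" for e :: "real \<Rightarrow> real" and e' x
    using has_vector_derivative_of_real[OF DERIV_fun_exp[OF that]]
    by (simp add: exp_of_real mult.commute)
  have dG: "((\<lambda>x. \<Sum>r\<in>A. F r x * exp (of_real (E r x))) has_vector_derivative G1 + G2) (at x)"
    unfolding G1_def G2_def sum.distrib[symmetric]
    by (rule has_vector_derivative_sum, rule has_vector_derivative_eq_rhs,
        rule has_vector_derivative_mult[OF F expd[OF E]]) (auto simp: algebra_simps)
  have dZ: "(Z has_real_derivative Z') (at x)"
    unfolding Z_def Z'_def by (rule DERIV_sum) (rule DERIV_fun_exp[OF U])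
  have dL: "((\<lambda>x. ln (Z x)) has_real_derivative Z' / Z x) (at x)"
    using DERIV_chain2[OF DERIV_ln_divide[OF Zpos] dZ] by simp
  have dpL: "((\<lambda>x. - p * of_real (ln (Z x))) has_vector_derivative - p * of_real (Z' / Z x)) (at x)"
    by (rule has_vector_derivative_mult_right[OF has_vector_derivative_of_real[OF dL]])
  have dY: "((\<lambda>x. exp (- p * of_real (ln (Z x)))) has_vector_derivative - p * of_real (Z' / Z x) * Y) (at x)"
    unfolding Y_def by (rule field_vector_diff_chain_at[OF dpL DERIV_exp, unfolded o_def])
  have Y1: "exp (- (p + 1) * of_real (ln (Z x))) = Y / of_real (Z x)"
  proof -
    have "exp (- (p + 1) * of_real (ln (Z x))) = Y * exp (- of_real (ln (Z x)))"
      unfolding Y_def by (simp add: exp_add[symmetric] algebra_simps)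
    also have "exp (- of_real (ln (Z x)) :: complex) = inverse (of_real (Z x))"
      using Zpos by (simp add: exp_minus exp_of_real)
    finally show ?thesis by (simp add: divide_inverse)
  qed
  have dbl: "(\<Sum>(r, s)\<in>A \<times> S. F r x * (of_real (E' r x) - p * of_real (U' s x)) * exp (of_real (E r x + U s x)))
      = G2 * of_real (Z x) - p * G * of_real Z'"
    unfolding G2_def G_def Z_def Z'_def sum.cartesian_product[symmetric] of_real_sum sum_product
      sum_distrib_left sum_distrib_right sum_subtractf[symmetric]
    by (subst sum.swap, intro sum.cong refl) (simp add: exp_add exp_of_real algebra_simps)
  have "((\<lambda>x. (\<Sum>r\<in>A. F r x * exp (of_real (E r x))) * exp (- p * of_real (ln (Z x))))
      has_vector_derivative G * (- p * of_real (Z' / Z x) * Y) + (G1 + G2) * Y) (at x)"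
    using has_vector_derivative_mult[OF dG dY] by (simp add: G_def Y_def)
  also have "G * (- p * of_real (Z' / Z x) * Y) + (G1 + G2) * Y
      = G1 * Y + (G2 * of_real (Z x) - p * G * of_real Z') * (Y / of_real (Z x))"
    using Zpos by (simp add: field_simps)
  finally show ?thesis
    unfolding dbl Z_def[symmetric] G1_def[symmetric] Y1 Y_def[symmetric] .
qed

section \<open>Gibbs averages over tuples of replicas\<close>

locale gaussian_interpolation =
  fixes I :: "'k set" and c c' :: "'k \<Rightarrow> real \<Rightarrow> real" and S :: "'s set"
    and a :: "'k \<Rightarrow> 's \<Rightarrow> real" and b :: "'s \<Rightarrow> real"
  assumes finite_I: "finite I" and finite_S: "finite S" and S_nonempty: "S \<noteq> {}"
    and c_deriv: "\<And>k t. (c k has_real_derivative c' k t) (at t)"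
    and c_le: "\<And>k t. \<bar>c k t\<bar> \<le> 1" and c'_le: "\<And>k t. \<bar>c' k t\<bar> \<le> 1"
begin

definition energy :: "('k \<Rightarrow> 'r \<Rightarrow> real) \<Rightarrow> ('r \<Rightarrow> real) \<Rightarrow> real \<Rightarrow> ('k \<Rightarrow> real) \<Rightarrow> 'r \<Rightarrow> real" where
  "energy a' b' t g r = (\<Sum>k\<in>I. c k t * g k * a' k r) + b' r"

definition Z :: "real \<Rightarrow> ('k \<Rightarrow> real) \<Rightarrow> real" where
  "Z t g = (\<Sum>s\<in>S. exp (energy a b t g s))"

text \<open>
  \<open>A\<close> indexes tuples of replicas, with energies \<open>energy a' b'\<close>; when these are the sums of the
  energies of \<open>n\<close> replicas and \<open>p = n - \<i> u\<close>, this is the Gibbs average of \<open>f\<close> times \<open>Z\<^sup>\<i>\<^sup>u\<close>.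
\<close>

definition gibbs ::
    "'r set \<Rightarrow> ('k \<Rightarrow> 'r \<Rightarrow> real) \<Rightarrow> ('r \<Rightarrow> real) \<Rightarrow> ('r \<Rightarrow> complex) \<Rightarrow> complex \<Rightarrow> real \<Rightarrow>
      ('k \<Rightarrow> real) \<Rightarrow> complex" where
  "gibbs A a' b' f p t g =
     (\<Sum>r\<in>A. f r * exp (of_real (energy a' b' t g r))) * exp (- p * of_real (ln (Z t g)))"

definition adjoin_a :: "('k \<Rightarrow> 'r \<Rightarrow> real) \<Rightarrow> 'k \<Rightarrow> 'r \<times> 's \<Rightarrow> real" where
  "adjoin_a a' k = (\<lambda>(r, s). a' k r + a k s)"

definition adjoin_b :: "('r \<Rightarrow> real) \<Rightarrow> 'r \<times> 's \<Rightarrow> real" where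
  "adjoin_b b' = (\<lambda>(r, s). b' r + b s)"

text \<open>Tuples of replicas are nested pairs of varying type, so the predicate records only the
  consequence that the estimates use: the partition sum of the tuple system is an exact power of
  \<open>Z\<close>.\<close>

definition replicas :: "nat \<Rightarrow> 'r set \<Rightarrow> ('k \<Rightarrow> 'r \<Rightarrow> real) \<Rightarrow> ('r \<Rightarrow> real) \<Rightarrow> bool" where
  "replicas n A a' b' \<longleftrightarrow> finite A \<and> (\<forall>t g. (\<Sum>r\<in>A. exp (energy a' b' t g r)) = Z t g ^ n)"

lemma Z_pos: "Z t g > 0"
  unfolding Z_def using finite_S S_nonempty by (intro sum_pos) auto

lemma energy_adjoin: "energy (adjoin_a a') (adjoin_b b') t g (r, s) = energy a' b' t g r + energy a b t g s"
  by (simp add: energy_def adjoin_a_def adjoin_b_def sum.distrib distrib_left)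

lemma energy_adjoin':
  "energy (adjoin_a a') (adjoin_b b') t g x = energy a' b' t g (fst x) + energy a b t g (snd x)"
  by (cases x) (simp add: energy_adjoin)

lemma replicas_zero: "replicas 0 {r} (\<lambda>_ _. 0) (\<lambda>_. 0)"
  by (simp add: replicas_def energy_def)

lemma replicas_adjoin:
  assumes "replicas n A a' b'"
  shows "replicas (Suc n) (A \<times> S) (adjoin_a a') (adjoin_b b')"
proof -
  have "(\<Sum>x\<in>A \<times> S. exp (energy (adjoin_a a') (adjoin_b b') t g x))
      = (\<Sum>r\<in>A. exp (energy a' b' t g r)) * Z t g" for t g
    unfolding Z_def sum_product sum.cartesian_product'
    by (intro sum.cong refl) (auto simp: energy_adjoin exp_add)
  then show ?thesis using assms finite_S by (simp add: replicas_def mult.commute)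
qed

lemma replicas_one: "replicas 1 S a b"
  by (simp add: replicas_def finite_S Z_def)

text \<open>The imaginary part of \<open>p\<close> contributes a phase, and its real part
  \<open>n\<close> cancels the \<open>n\<close> partition functions. Uniformity in \<open>t\<close>
  and \<open>g\<close> is what domination and integration by parts require.\<close>

lemma gibbs_norm_le:
  assumes "replicas n A a' b'" and "Re p = real n" and f: "\<And>r. r \<in> A \<Longrightarrow> norm (f r) \<le> C"
  shows "norm (gibbs A a' b' f p t g) \<le> C"
proof -
  have "norm (\<Sum>r\<in>A. f r * exp (of_real (energy a' b' t g r))) \<le> (\<Sum>r\<in>A. C * exp (energy a' b' t g r))"
    by (rule sum_norm_le) (auto simp: norm_mult f mult_right_mono)
  also have "\<dots> = C * Z t g ^ n"
    using assms(1) by (simp add: replicas_def sum_distrib_left[symmetric])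
  finally have le: "norm (\<Sum>r\<in>A. f r * exp (of_real (energy a' b' t g r))) \<le> C * Z t g ^ n" .
  have "norm (gibbs A a' b' f p t g) \<le> C * Z t g ^ n * exp (- real n * ln (Z t g))"
    unfolding gibbs_def norm_mult using assms(2) by (intro mult_mono le order_trans[OF norm_ge_zero le]) auto
  also have "exp (- real n * ln (Z t g)) = inverse (Z t g ^ n)"
    using Z_pos[of t g] by (simp add: exp_minus exp_of_nat_mult)
  also have "C * Z t g ^ n * inverse (Z t g ^ n) = C" using Z_pos[of t g] by simp
  finally show ?thesis .
qed

lemma energy_deriv_t:
  "((\<lambda>t. energy a' b' t g r) has_real_derivative (\<Sum>k\<in>I. c' k t * g k * a' k r)) (at t)"
proof -
  have "((\<lambda>t. \<Sum>k\<in>I. c k t * g k * a' k r) has_real_derivative (\<Sum>k\<in>I. c' k t * g k * a' k r)) (at t)"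
    by (intro DERIV_sum DERIV_cmult_right c_deriv)
  then show ?thesis
    unfolding energy_def by (rule DERIV_cong[OF DERIV_add[OF _ DERIV_const]]) simp
qed

lemma energy_deriv_g:
  assumes "k \<in> I"
  shows "((\<lambda>y. energy a' b' t (g(k := y)) r) has_real_derivative c k t * a' k r) (at x)"
proof -
  define d where "d = (\<Sum>j\<in>I - {k}. c j t * g j * a' j r) + b' r"
  have "energy a' b' t (g(k := y)) r = c k t * a' k r * y + d" for y
    unfolding energy_def d_def sum.remove[OF finite_I assms] by (simp add: mult_ac)
  moreover have "((\<lambda>y. c k t * a' k r * y + d) has_real_derivative c k t * a' k r) (at x)"
    by (auto intro!: derivative_eq_intros)
  ultimately show ?thesis by simp
qed

lemma gibbs_deriv_t:
  fixes p :: complex and f :: "real \<Rightarrow> 'r \<Rightarrow> complex" and f' :: "'r \<Rightarrow> complex"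
  assumes "finite A" and f: "\<And>r. r \<in> A \<Longrightarrow> ((\<lambda>t. f t r) has_vector_derivative f' r) (at t)"
  shows "((\<lambda>t. gibbs A a' b' (f t) p t g) has_vector_derivative
    gibbs A a' b' f' p t g + (\<Sum>k\<in>I. of_real (c' k t) * (of_real (g k) *
      gibbs (A \<times> S) (adjoin_a a') (adjoin_b b') (\<lambda>(r, s). f t r * (a' k r - p * a k s)) (p + 1) t g))) (at t)"
proof -
  have "(\<Sum>(r, s)\<in>A \<times> S. f t r * (of_real (\<Sum>k\<in>I. c' k t * g k * a' k r) - p * of_real (\<Sum>k\<in>I. c' k t * g k * a k s))
          * exp (of_real (energy a' b' t g r + energy a b t g s)))
      = (\<Sum>k\<in>I. of_real (c' k t) * (of_real (g k) * (\<Sum>(r, s)\<in>A \<times> S. f t r * (a' k r - p * a k s)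
          * exp (of_real (energy a' b' t g r + energy a b t g s)))))" (is "?l = ?r")
  proof -
    have "?l = (\<Sum>(r, s)\<in>A \<times> S. \<Sum>k\<in>I. of_real (c' k t) * (of_real (g k) * (f t r * (a' k r - p * a k s)
          * exp (of_real (energy a' b' t g r + energy a b t g s)))))"
      by (intro sum.cong refl)
        (auto simp: sum_distrib_left sum_distrib_right sum_subtractf[symmetric] algebra_simps intro!: sum.cong)
    also have "\<dots> = ?r"
      unfolding case_prod_unfold by (subst sum.swap) (simp add: sum_distrib_left)
    finally show ?thesis .
  qed
  note eq = this
  have R: "(\<Sum>k\<in>I. of_real (c' k t) * (of_real (g k) *
      gibbs (A \<times> S) (adjoin_a a') (adjoin_b b') (\<lambda>(r, s). f t r * (a' k r - p * a k s)) (p + 1) t g))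
    = (\<Sum>(r, s)\<in>A \<times> S. f t r * (of_real (\<Sum>k\<in>I. c' k t * g k * a' k r) - p * of_real (\<Sum>k\<in>I. c' k t * g k * a k s))
          * exp (of_real (energy a' b' t g r + energy a b t g s))) * exp (- (p + 1) * of_real (ln (Z t g)))"
    unfolding eq by (simp only: gibbs_def case_prod_unfold energy_adjoin' sum_distrib_right mult.assoc)
  show ?thesis
    unfolding R unfolding gibbs_def Z_def
    by (rule has_vector_derivative_gibbs_quotient[where F="\<lambda>r t. f t r" and F'="\<lambda>r _. f' r"
        and E="\<lambda>r t. energy a' b' t g r" and U="\<lambda>s t. energy a b t g s" and p=p
        and E'="\<lambda>r t. \<Sum>k\<in>I. c' k t * g k * a' k r" and U'="\<lambda>s t. \<Sum>k\<in>I. c' k t * g k * a k s",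
        OF assms(1) finite_S S_nonempty]) (rule energy_deriv_t, rule energy_deriv_t, erule f)
qed

lemma gibbs_deriv_g:
  fixes p :: complex and f :: "'r \<Rightarrow> complex"
  assumes "finite A" "k \<in> I"
  shows "((\<lambda>y. gibbs A a' b' f p t (g(k := y))) has_vector_derivative
    gibbs (A \<times> S) (adjoin_a a') (adjoin_b b') (\<lambda>(r, s). f r * (c k t * (a' k r - p * a k s))) (p + 1) t (g(k := x))) (at x)"
  using has_vector_derivative_gibbs_quotient[where F="\<lambda>r _. f r" and F'="\<lambda>r _. 0" and p=p
      and E="\<lambda>r y. energy a' b' t (g(k := y)) r" and U="\<lambda>s y. energy a b t (g(k := y)) s"
      and E'="\<lambda>r _. c k t * a' k r" and U'="\<lambda>s _. c k t * a k s",
      OF assms(1) finite_S S_nonempty energy_deriv_g[OF assms(2)] energy_deriv_g[OF assms(2)]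
        has_vector_derivative_const]
  by (simp add: gibbs_def Z_def case_prod_unfold energy_adjoin' right_diff_distrib mult_ac)

lemma gibbs_measurable [measurable]: "gibbs A a' b' f p t \<in> borel_measurable (std_gaussian I)"
  unfolding gibbs_def[abs_def] Z_def energy_def by measurable

lemma integrable_gibbs:
  assumes "replicas n A a' b'" "Re p = real n"
  shows "integrable (std_gaussian I) (gibbs A a' b' f p t)"
proof -
  have "norm (gibbs A a' b' f p t g) \<le> (\<Sum>r\<in>A. norm (f r))" for g
    using assms by (intro gibbs_norm_le[OF assms] member_le_sum) (auto simp: replicas_def)
  then show ?thesis by (intro integrable_bounded_std_gaussian gibbs_measurable)
qed

lemma gibbs_sum: "gibbs A a' b' (\<lambda>r. \<Sum>k\<in>K. f k r) p t g = (\<Sum>k\<in>K. gibbs A a' b' (f k) p t g)"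
  unfolding gibbs_def sum_distrib_right by (rule sum.swap)

lemma gibbs_cmult: "gibbs A a' b' (\<lambda>r. z * f r) p t g = z * gibbs A a' b' f p t g"
  by (simp add: gibbs_def sum_distrib_left mult.assoc)

lemma gibbs_cong: "(\<And>r. r \<in> A \<Longrightarrow> f r = f' r) \<Longrightarrow> gibbs A a' b' f p t g = gibbs A a' b' f' p t g"
  by (simp add: gibbs_def)

lemma gibbs_add: "gibbs A a' b' (\<lambda>r. f r + f' r) p t g = gibbs A a' b' f p t g + gibbs A a' b' f' p t g"
  by (simp add: gibbs_def distrib_right sum.distrib)

text \<open>Differentiation in time brings down Gaussian factors \<open>g k\<close> and a new
  replica \<open>s\<close>; integration by parts trades each \<open>g k\<close> for a derivative in
  that coordinate, hence a factor \<open>c k t\<close> and a second new replica \<open>s'\<close>.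
  The two linear factors are these two uses of the quotient rule, with exponents \<open>p\<close>
  and \<open>p + 1\<close>.\<close>

theorem gibbs_interpolation:
  fixes p :: complex and f f' :: "real \<Rightarrow> 'r \<Rightarrow> complex"
  assumes rep: "replicas n A a' b'" and p: "Re p = real n"
    and f: "\<And>r t. r \<in> A \<Longrightarrow> ((\<lambda>t. f t r) has_vector_derivative f' t r) (at t)"
    and f_bound: "\<And>r t. r \<in> A \<Longrightarrow> norm (f t r) \<le> C" and f'_bound: "\<And>r t. r \<in> A \<Longrightarrow> norm (f' t r) \<le> C"
  shows "((\<lambda>t. \<integral>g. gibbs A a' b' (f t) p t g \<partial>std_gaussian I) has_vector_derivative
    (\<integral>g. gibbs A a' b' (f' t) p t g \<partial>std_gaussian I)
    + (\<integral>g. gibbs ((A \<times> S) \<times> S) (adjoin_a (adjoin_a a')) (adjoin_b (adjoin_b b'))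
        (\<lambda>((r, s), s'). f t r * (\<Sum>k\<in>I. (c k t * c' k t) * (a' k r - p * a k s)
           * (a' k r + a k s - (p + 1) * a k s'))) (p + 2) t g \<partial>std_gaussian I)) (at t)"
proof -
  have fin: "finite A" using rep by (simp add: replicas_def)
  have pp: "p + 1 + 1 = p + 2" by simp
  have p1: "Re (p + 1) = real (Suc n)" and p2: "Re (p + 1 + 1) = real (Suc (Suc n))" using p by auto
  note rep1 = replicas_adjoin[OF rep] and rep2 = replicas_adjoin[OF replicas_adjoin[OF rep]]
  define h where "h t k = (\<lambda>(r, s). f t r * (of_real (a' k r) - p * of_real (a k s)))" for t k
  define G where "G t k = gibbs (A \<times> S) (adjoin_a a') (adjoin_b b') (h t k) (p + 1) t" for t k
  define C' where "C' k = \<bar>C\<bar> * (\<Sum>(r, s)\<in>A \<times> S. norm (of_real (a' k r) - p * of_real (a k s)))" for k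
  have h_bound: "norm (h t k x) \<le> C' k" if x_in: "x \<in> A \<times> S" for t k x
  proof -
    obtain r s where x: "x = (r, s)" "r \<in> A" "s \<in> S" using x_in by auto
    have "norm (h t k x) \<le> \<bar>C\<bar> * norm (of_real (a' k r) - p * of_real (a k s))"
      unfolding h_def x prod.case norm_mult using f_bound[OF x(2), of t] by (intro mult_right_mono) auto
    also have "\<dots> \<le> C' k"
      unfolding C'_def using fin finite_S x
      by (intro mult_left_mono member_le_sum[where i="(r, s)" and f="\<lambda>(r, s). norm (of_real (a' k r) - p * of_real (a k s))", simplified]) auto
    finally show ?thesis .
  qed
  have G_bound: "norm (G t k g) \<le> C' k" for t k g
    unfolding G_def by (rule gibbs_norm_le[OF rep1 p1 h_bound])
  have G_meas: "G t k \<in> borel_measurable (std_gaussian I)" for t k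
    unfolding G_def by measurable
  have gG_meas: "(\<lambda>g. of_real (g k) * G t k g) \<in> borel_measurable (std_gaussian I)" if "k \<in> I" for t k
  proof -
    have [measurable]: "(\<lambda>g. g k) \<in> borel_measurable (std_gaussian I)"
      using that by (simp add: measurable_component_singleton)
    show ?thesis using G_meas by measurable
  qed
  \<comment> \<open>The factor \<open>g k\<close> is unbounded, so the time derivative is dominated
    by multiples of \<open>\<bar>g k\<bar>\<close> and not by a constant.\<close>
  have abs_int: "integrable (std_gaussian I) (\<lambda>g. C' k * \<bar>g k\<bar>)" if "k \<in> I" for k
    using integrable_std_gaussian_component[OF finite_I that] by auto
  have gG_bound: "norm (of_real (g k) * G t k g) \<le> C' k * \<bar>g k\<bar>" for g t k
    using mult_right_mono[OF G_bound, of "\<bar>g k\<bar>" t k g] by (simp add: norm_mult mult.commute)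
  have gG_int: "integrable (std_gaussian I) (\<lambda>g. of_real (g k) * G t k g)" if "k \<in> I" for t k
    by (rule Bochner_Integration.integrable_bound[OF abs_int[OF that] gG_meas[OF that]])
      (intro AE_I2 order_trans[OF gG_bound], simp)
  have deriv: "((\<lambda>t. \<integral>g. gibbs A a' b' (f t) p t g \<partial>std_gaussian I) has_vector_derivative
    (\<integral>g. gibbs A a' b' (f' t) p t g + (\<Sum>k\<in>I. of_real (c' k t) * (of_real (g k) * G t k g)) \<partial>std_gaussian I)) (at t)"
  proof (rule has_vector_derivative_integral_dominated)
    show "integrable (std_gaussian I) (gibbs A a' b' (f t) p t)" for t
      by (rule integrable_gibbs[OF rep p])
    show "(\<lambda>g. gibbs A a' b' (f' t) p t g + (\<Sum>k\<in>I. of_real (c' k t) * (of_real (g k) * G t k g)))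
        \<in> borel_measurable (std_gaussian I)" for t
      by (intro borel_measurable_add borel_measurable_sum gibbs_measurable
          borel_measurable_times[OF borel_measurable_const gG_meas])
    show "((\<lambda>t. gibbs A a' b' (f t) p t g) has_vector_derivative
        gibbs A a' b' (f' t) p t g + (\<Sum>k\<in>I. of_real (c' k t) * (of_real (g k) * G t k g))) (at t)" for t g
      unfolding G_def h_def by (rule gibbs_deriv_t[OF fin f])
    show "integrable (std_gaussian I) (\<lambda>g. C + (\<Sum>k\<in>I. C' k * \<bar>g k\<bar>))"
      using abs_int prob_space.finite_measure[OF prob_space_std_gaussian, of I]
      by (intro Bochner_Integration.integrable_add Bochner_Integration.integrable_sum) (auto intro: finite_measure.integrable_const)
    show "norm (gibbs A a' b' (f' t) p t g + (\<Sum>k\<in>I. of_real (c' k t) * (of_real (g k) * G t k g)))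
        \<le> C + (\<Sum>k\<in>I. C' k * \<bar>g k\<bar>)" for t g
    proof (intro norm_triangle_le add_mono sum_norm_le)
      show "norm (gibbs A a' b' (f' t) p t g) \<le> C" by (rule gibbs_norm_le[OF rep p f'_bound])
      show "norm (of_real (c' k t) * (of_real (g k) * G t k g)) \<le> C' k * \<bar>g k\<bar>" for k
        using mult_mono[OF c'_le[of k t] gG_bound[of g k t]] by (simp add: norm_mult)
    qed
  qed
  define D where "D k = gibbs ((A \<times> S) \<times> S) (adjoin_a (adjoin_a a')) (adjoin_b (adjoin_b b'))
     (\<lambda>((r, s), s'). f t r * (of_real (a' k r) - p * of_real (a k s)) * (c k t * (of_real (a' k r + a k s) - (p + 1) * a k s')))
     (p + 2) t" for k
  have stein: "(\<integral>g. of_real (g k) * G t k g \<partial>std_gaussian I) = (\<integral>g. D k g \<partial>std_gaussian I)" if k: "k \<in> I" for k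
  proof (rule stein_std_gaussian[OF finite_I k])
    define d where "d = (\<lambda>(x, s'). h t k x * (of_real (c k t) * (of_real (adjoin_a a' k x) - (p + 1) * of_real (a k s'))))"
    have D_eq: "D k = gibbs ((A \<times> S) \<times> S) (adjoin_a (adjoin_a a')) (adjoin_b (adjoin_b b')) d (p + 1 + 1) t"
      unfolding D_def pp by (intro ext gibbs_cong) (auto simp: d_def h_def adjoin_a_def)
    have finA: "finite (A \<times> S)" "finite ((A \<times> S) \<times> S)" using fin finite_S by auto
    show dG: "((\<lambda>y. G t k (g(k := y))) has_vector_derivative D k (g(k := x))) (at x)" for g x
      unfolding D_eq G_def d_def by (rule gibbs_deriv_g[OF finA(1) k])
    \<comment> \<open>\<open>D k\<close> is again a Gibbs average, so its continuity comes from
      differentiating once more.\<close>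
    show "continuous_on UNIV (\<lambda>x. D k (g(k := x)))" for g
      unfolding D_eq using gibbs_deriv_g[OF finA(2) k]
      by (intro continuous_at_imp_continuous_on ballI has_vector_derivative_continuous)
    define B where "B = max (C' k) (\<Sum>x\<in>(A \<times> S) \<times> S. norm (d x))"
    show "norm (G t k g) \<le> B" for g using G_bound[of t k g] by (simp add: B_def)
    show "norm (D k g) \<le> B" for g
      unfolding D_eq using finA
      by (intro gibbs_norm_le[OF rep2 p2]) (auto simp: B_def intro!: max.coboundedI2 member_le_sum)
    show "D k \<in> borel_measurable (std_gaussian I)" unfolding D_eq by measurable
  qed (rule G_meas)
  have "(\<integral>g. gibbs A a' b' (f' t) p t g + (\<Sum>k\<in>I. of_real (c' k t) * (of_real (g k) * G t k g)) \<partial>std_gaussian I)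
      = (\<integral>g. gibbs A a' b' (f' t) p t g \<partial>std_gaussian I)
        + (\<Sum>k\<in>I. of_real (c' k t) * (\<integral>g. of_real (g k) * G t k g \<partial>std_gaussian I))"
    using integrable_gibbs[OF rep p] gG_int
    by (subst Bochner_Integration.integral_add) (auto simp: Bochner_Integration.integral_sum)
  also have "(\<Sum>k\<in>I. of_real (c' k t) * (\<integral>g. of_real (g k) * G t k g \<partial>std_gaussian I))
      = (\<Sum>k\<in>I. \<integral>g. of_real (c' k t) * D k g \<partial>std_gaussian I)"
    using stein by simp
  also have "\<dots> = (\<integral>g. (\<Sum>k\<in>I. of_real (c' k t) * D k g) \<partial>std_gaussian I)"
    unfolding D_def using p2
    by (intro Bochner_Integration.integral_sum[symmetric] integrable_mult_right integrable_gibbs[OF rep2]) (simp add: add.assoc)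
  also have "(\<lambda>g. \<Sum>k\<in>I. of_real (c' k t) * D k g) =
     gibbs ((A \<times> S) \<times> S) (adjoin_a (adjoin_a a')) (adjoin_b (adjoin_b b'))
        (\<lambda>((r, s), s'). f t r * (\<Sum>k\<in>I. (c k t * c' k t) * (a' k r - p * a k s)
           * (a' k r + a k s - (p + 1) * a k s'))) (p + 2) t"
    unfolding D_def gibbs_cmult[symmetric] gibbs_sum[symmetric]
    by (intro ext gibbs_cong) (auto simp: sum_distrib_left mult_ac)
  finally show ?thesis using deriv by simp
qed

end

section \<open>The Sherrington-Kirkpatrick model along the interpolation\<close>

text \<open>Expand the nonnegative double sum of u_i u_j (\<phi>(x_i) - \<phi>(x_j)) (x_i - x_j). It
  will replace an average over two independent pairs of replicas by one over a single pair.\<close>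

lemma weighted_chebyshev_sum:
  fixes u x :: "'a \<Rightarrow> real" and \<phi> :: "real \<Rightarrow> real"
  assumes u: "\<And>i. i \<in> A \<Longrightarrow> 0 \<le> u i" "(\<Sum>i\<in>A. u i) = 1" and \<phi>: "mono \<phi>"
  shows "(\<Sum>i\<in>A. u i * \<phi> (x i)) * (\<Sum>i\<in>A. u i * x i) \<le> (\<Sum>i\<in>A. u i * (\<phi> (x i) * x i))"
proof -
  let ?T = "\<Sum>i\<in>A. u i * (\<phi> (x i) * x i)" and ?P = "\<Sum>i\<in>A. u i * \<phi> (x i)" and ?Q = "\<Sum>i\<in>A. u i * x i"
  have "0 \<le> (\<phi> s - \<phi> t) * (s - t)" for s t
    using \<phi> by (cases "s \<le> t") (auto simp: mono_def mult_nonneg_nonneg mult_nonpos_nonpos)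
  then have "0 \<le> (\<Sum>i\<in>A. \<Sum>j\<in>A. u i * u j * ((\<phi> (x i) - \<phi> (x j)) * (x i - x j)))"
    using u by (intro sum_nonneg) (simp add: mult_nonneg_nonneg)
  also have "\<dots> = (\<Sum>i\<in>A. \<Sum>j\<in>A. (u i * (\<phi> (x i) * x i)) * u j + u i * (u j * (\<phi> (x j) * x j))
      - (u i * \<phi> (x i)) * (u j * x j) - (u i * x i) * (u j * \<phi> (x j)))"
    by (intro sum.cong refl) (simp add: algebra_simps)
  also have "\<dots> = ?T * 1 + 1 * ?T - ?P * ?Q - ?Q * ?P"
    by (simp add: sum.distrib sum_subtractf sum_product[symmetric] u(2))
  finally show ?thesis by (simp add: mult.commute[of ?Q ?P])
qed

definition pairs :: "nat \<Rightarrow> (nat \<times> nat) set" where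
  "pairs N = {(i, j). 1 \<le> i \<and> i < j \<and> j \<le> N}"

lemma finite_pairs: "finite (pairs N)"
  by (rule finite_subset[of _ "{..N} \<times> {..N}"]) (auto simp: pairs_def)

lemma sum_pairs:
  fixes x :: "nat \<Rightarrow> real"
  shows "2 * (\<Sum>(i, j)\<in>pairs N. x i * x j) = (\<Sum>i=1..N. x i)\<^sup>2 - (\<Sum>i=1..N. (x i)\<^sup>2)"
proof (induction N)
  case 0
  have "pairs 0 = {}" by (auto simp: pairs_def)
  then show ?case by simp
next
  case (Suc N)
  have eq: "pairs (Suc N) = pairs N \<union> (\<lambda>i. (i, Suc N)) ` {1..N}"
    by (auto simp: pairs_def le_Suc_eq)
  have "(\<Sum>(i, j)\<in>pairs (Suc N). x i * x j)
      = (\<Sum>(i, j)\<in>pairs N. x i * x j) + (\<Sum>(i, j)\<in>(\<lambda>i. (i, Suc N)) ` {1..N}. x i * x j)"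
    unfolding eq by (rule sum.union_disjoint) (auto simp: finite_pairs, auto simp: pairs_def)
  also have "(\<Sum>(i, j)\<in>(\<lambda>i. (i, Suc N)) ` {1..N}. x i * x j) = (\<Sum>i=1..N. x i) * x (Suc N)"
    by (subst sum.reindex) (auto simp: inj_on_def sum_distrib_right)
  finally show ?case using Suc by (simp add: power2_eq_square algebra_simps)
qed

lemma finite_spin_configs: "finite (spin_configs N)"
  unfolding spin_configs_def by (intro finite_PiE) auto

lemma spin_configs_nonempty: "spin_configs N \<noteq> {}"
  unfolding spin_configs_def by (auto simp: PiE_eq_empty_iff)

lemma spin_square:
  assumes "\<sigma> \<in> spin_configs N" "i \<in> {1..N}"
  shows "\<sigma> i * \<sigma> i = 1"
proof -
  have "\<sigma> i \<in> {-1, 1}" using assms unfolding spin_configs_def by (rule PiE_mem)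
  then show ?thesis by auto
qed

definition sk_index :: "nat \<Rightarrow> ((nat \<times> nat) + nat) set" where
  "sk_index N = pairs N <+> {1..N}"

lemma finite_sk_index: "finite (sk_index N)"
  by (simp add: sk_index_def finite_pairs)

text \<open>Weight times derivative is sin t cos t for the couplings and - sin t cos t for the
  fields; the opposite signs are what completes the square in the overlap.\<close>

definition trig :: "'a + 'b \<Rightarrow> real \<Rightarrow> real" where
  "trig k t = (case k of Inl _ \<Rightarrow> sin t | Inr _ \<Rightarrow> cos t)"

definition trig' :: "'a + 'b \<Rightarrow> real \<Rightarrow> real" where
  "trig' k t = (case k of Inl _ \<Rightarrow> cos t | Inr _ \<Rightarrow> - sin t)"

definition sk_coeff :: "real \<Rightarrow> real \<Rightarrow> nat \<Rightarrow> (nat \<times> nat) + nat \<Rightarrow> (nat \<Rightarrow> real) \<Rightarrow> real" where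
  "sk_coeff \<beta> q N k \<sigma> = (case k of Inl (i, j) \<Rightarrow> \<beta> / sqrt (real N) * (\<sigma> i * \<sigma> j) | Inr i \<Rightarrow> \<beta> * sqrt q * \<sigma> i)"

definition sk_field :: "real \<Rightarrow> nat \<Rightarrow> (nat \<Rightarrow> real) \<Rightarrow> real" where
  "sk_field h N \<sigma> = h * (\<Sum>i=1..N. \<sigma> i)"

text \<open>\<open>deviation q N \<sigma> \<tau> = N (R - q)\<^sup>2\<close>, where \<open>R\<close> is the overlap of \<open>\<sigma>\<close> and \<open>\<tau>\<close>.\<close>

definition deviation :: "real \<Rightarrow> nat \<Rightarrow> (nat \<Rightarrow> real) \<Rightarrow> (nat \<Rightarrow> real) \<Rightarrow> real" where
  "deviation q N \<sigma> \<tau> = (\<Sum>i=1..N. \<sigma> i * \<tau> i - q)\<^sup>2 / real N"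

lemma deviation_nonneg: "0 \<le> deviation q N \<sigma> \<tau>"
  by (simp add: deviation_def)

lemma deviation_commute: "deviation q N \<sigma> \<tau> = deviation q N \<tau> \<sigma>"
  by (simp add: deviation_def mult.commute)

lemma deviation_self:
  assumes "\<sigma> \<in> spin_configs N" "N \<ge> 1"
  shows "deviation q N \<sigma> \<sigma> = real N * (1 - q)\<^sup>2"
proof -
  have "(\<Sum>i=1..N. \<sigma> i * \<sigma> i - q) = (\<Sum>i=1..N. 1 - q)"
    by (intro sum.cong) (auto simp: spin_square[OF assms(1)])
  then show ?thesis using assms by (simp add: deviation_def power2_eq_square)
qed

text \<open>For \<open>\<beta> \<le> 1 / 4\<close> the total loss 2 \<beta>^2 of the exponent
  \<open>rate\<close> is at most 1/8, half of its initial value.\<close>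

locale sk_interpolation =
  fixes \<beta> h q :: real and N :: nat
  assumes N_pos: "N \<ge> 1" and q_range: "0 \<le> q" "q \<le> 1" and \<beta>_range: "0 < \<beta>" "\<beta> \<le> 1 / 4"
    and q_eq: "q = (LINT y|std_normal_distribution. (tanh (\<beta> * sqrt q * y + h))\<^sup>2)"
begin

sublocale gaussian_interpolation "sk_index N" trig trig' "spin_configs N" "sk_coeff \<beta> q N" "sk_field h N"
proof
  show "(trig k has_real_derivative trig' k t) (at t)" for k :: "'x + 'y" and t
    unfolding trig_def[abs_def] trig'_def by (cases k) (auto intro!: derivative_eq_intros)
  show "\<bar>trig k t\<bar> \<le> 1" "\<bar>trig' k t\<bar> \<le> 1" for k :: "'x + 'y" and t
    by (auto simp: trig_def trig'_def split: sum.split)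
qed (auto simp: finite_sk_index finite_spin_configs spin_configs_nonempty)

abbreviation \<Sigma> where "\<Sigma> \<equiv> spin_configs N"
abbreviation a where "a \<equiv> sk_coeff \<beta> q N"
abbreviation b where "b \<equiv> sk_field h N"
abbreviation I where "I \<equiv> sk_index N"
abbreviation X where "X \<equiv> deviation q N"
abbreviation \<kappa> where "\<kappa> t \<equiv> \<beta>\<^sup>2 * sin t * cos t"

text \<open>With s = N R, the couplings contribute (s^2 - N) / (2 N) and the fields - q s, both
  times \<open>\<kappa> t\<close>. Completing the square leaves half the deviation and a constant
  independent of the configurations.\<close>

lemma covariance:
  assumes "\<sigma> \<in> \<Sigma>" "\<tau> \<in> \<Sigma>"
  shows "(\<Sum>k\<in>I. trig k t * trig' k t * (a k \<sigma> * a k \<tau>)) = \<kappa> t * (X \<sigma> \<tau> / 2 - (real N * q\<^sup>2 + 1) / 2)"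
proof -
  define x where "x i = \<sigma> i * \<tau> i" for i
  have x2: "(x i)\<^sup>2 = 1" if "i \<in> {1..N}" for i
  proof -
    have "(x i)\<^sup>2 = (\<sigma> i * \<sigma> i) * (\<tau> i * \<tau> i)" by (simp add: x_def power2_eq_square mult_ac)
    then show ?thesis by (simp add: spin_square[OF assms(1) that] spin_square[OF assms(2) that])
  qed
  define s where "s = (\<Sum>i=1..N. x i)"
  have s2: "2 * (\<Sum>(i, j)\<in>pairs N. x i * x j) = s\<^sup>2 - real N"
    unfolding sum_pairs s_def by (simp add: x2)
  have "(\<Sum>k\<in>I. trig k t * trig' k t * (a k \<sigma> * a k \<tau>))
      = (\<Sum>p\<in>pairs N. sin t * cos t * (\<beta>\<^sup>2 / N) * (x (fst p) * x (snd p)))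
        + (\<Sum>i=1..N. - (cos t * sin t * (\<beta>\<^sup>2 * q) * x i))"
    using N_pos q_range
    unfolding sk_index_def by (subst sum.Plus) (auto simp: finite_pairs trig_def trig'_def sk_coeff_def x_def case_prod_unfold
        power2_eq_square mult_ac intro!: sum.cong arg_cong2[where f="(+)"])
  also have "\<dots> = sin t * cos t * (\<beta>\<^sup>2 / N) * ((s\<^sup>2 - real N) / 2) - cos t * sin t * (\<beta>\<^sup>2 * q) * s"
    unfolding s2[symmetric] by (simp add: sum_distrib_left sum_negf s_def case_prod_unfold mult_ac)
  also have "\<dots> = \<kappa> t * ((s - N * q)\<^sup>2 / N / 2 - (real N * q\<^sup>2 + 1) / 2)"
    using N_pos by (simp add: field_simps power2_eq_square)
  also have "(s - N * q)\<^sup>2 / N = X \<sigma> \<tau>"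
    by (simp add: deviation_def s_def x_def sum_subtractf)
  finally show ?thesis .
qed

definition weight :: "real \<Rightarrow> ((nat \<times> nat) + nat \<Rightarrow> real) \<Rightarrow> (nat \<Rightarrow> real) \<Rightarrow> real" where
  "weight t g \<sigma> = exp (energy a b t g \<sigma>) / Z t g"

lemma weight_nonneg: "0 \<le> weight t g \<sigma>"
  using Z_pos[of t g] by (simp add: weight_def)

lemma sum_weight: "(\<Sum>\<sigma>\<in>\<Sigma>. weight t g \<sigma>) = 1"
  using Z_pos[of t g] by (simp add: weight_def sum_divide_distrib[symmetric] Z_def)

lemma exp_nat_ln_Z: "exp (- (of_nat n :: complex) * of_real (ln (Z t g))) = of_real (inverse (Z t g ^ n))"
proof -
  have "exp (- (of_nat n :: complex) * of_real (ln (Z t g))) = exp (of_real (- (real n * ln (Z t g))))" by simp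
  also have "\<dots> = of_real (exp (- (real n * ln (Z t g))))" by (rule exp_of_real)
  also have "exp (- (real n * ln (Z t g))) = inverse (Z t g ^ n)"
    using Z_pos[of t g] by (simp add: exp_minus exp_of_nat_mult)
  finally show ?thesis .
qed

lemma gibbs_two:
  "gibbs (\<Sigma> \<times> \<Sigma>) (adjoin_a a) (adjoin_b b) (\<lambda>r. of_real (f r)) 2 t g
    = of_real (\<Sum>(s, s')\<in>\<Sigma> \<times> \<Sigma>. weight t g s * weight t g s' * f (s, s'))"
  using exp_nat_ln_Z[of 2] unfolding gibbs_def
  by (simp add: energy_adjoin' exp_add exp_of_real weight_def case_prod_unfold sum_distrib_right
      sum_distrib_left power2_eq_square mult_ac divide_inverse)

lemma gibbs_four:
  "gibbs (((\<Sigma> \<times> \<Sigma>) \<times> \<Sigma>) \<times> \<Sigma>) (adjoin_a (adjoin_a (adjoin_a a))) (adjoin_b (adjoin_b (adjoin_b b)))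
      (\<lambda>r. of_real (f r)) 4 t g
    = of_real (\<Sum>(((s1, s2), s3), s4)\<in>((\<Sigma> \<times> \<Sigma>) \<times> \<Sigma>) \<times> \<Sigma>.
        weight t g s1 * weight t g s2 * (weight t g s3 * weight t g s4) * f (((s1, s2), s3), s4))"
  using exp_nat_ln_Z[of 4] unfolding gibbs_def
  by (simp add: energy_adjoin' exp_add exp_of_real weight_def case_prod_unfold sum_distrib_right
      sum_distrib_left power4_eq_xxxx mult_ac divide_inverse)

lemma replicas_two: "replicas 2 (\<Sigma> \<times> \<Sigma>) (adjoin_a a) (adjoin_b b)"
  using replicas_adjoin[OF replicas_one] by (simp add: numeral_2_eq_2)

text \<open>
  The exponent \<open>rate t\<close> decreases just fast enough to compensate the growth of the exponential
  moment of the overlap that is caused by switching on the pair interaction.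
\<close>

definition rate :: "real \<Rightarrow> real" where
  "rate t = 1 / 4 - 2 * \<beta>\<^sup>2 * (sin t)\<^sup>2"

lemma rate_ge: "1 / 8 \<le> rate t"
proof -
  have "\<beta>\<^sup>2 * (sin t)\<^sup>2 \<le> (1 / 4)\<^sup>2 * 1"
    using \<beta>_range by (intro mult_mono power_mono) (auto simp: abs_square_le_1)
  then show ?thesis by (simp add: rate_def power2_eq_square)
qed

lemma rate_le: "rate t \<le> 1 / 4"
  by (simp add: rate_def)

text \<open>The factor 4 is matched to the total weight 1 + 3 of the two deviations in the
  four-replica estimate.\<close>

lemma rate_deriv: "(rate has_real_derivative - 4 * \<kappa> t) (at t)"
  unfolding rate_def[abs_def] by (auto intro!: derivative_eq_intros)

definition moment :: "real \<Rightarrow> real" where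
  "moment t = (\<integral>g. (\<Sum>(s, s')\<in>\<Sigma> \<times> \<Sigma>. weight t g s * weight t g s' * exp (rate t * X s s')) \<partial>std_gaussian I)"

text \<open>The constant of the covariance cancels because 1 + 1 - 2 = 0 in the first factor, and
  the diagonal terms cancel because they enter with the same weights 1, 1, -2. Of the remaining
  deviations only those of the pairs (1, 2) and (3, 4) have a positive sign; the mixed ones are
  dropped.\<close>

lemma four_replica_bound:
  assumes \<kappa>: "0 \<le> \<kappa> t" and s: "s1 \<in> \<Sigma>" "s2 \<in> \<Sigma>" "s3 \<in> \<Sigma>" "s4 \<in> \<Sigma>"
  shows "(\<Sum>k\<in>I. trig k t * trig' k t * (a k s1 + a k s2 - 2 * a k s3) * (a k s1 + a k s2 + a k s3 - 3 * a k s4))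
    \<le> \<kappa> t * (X s1 s2 + 3 * X s3 s4)" (is "?l \<le> _")
proof -
  let ?C = "\<lambda>s s'. \<Sum>k\<in>I. trig k t * trig' k t * (a k s * a k s')"
  have "?l = ?C s1 s1 + ?C s1 s2 + ?C s1 s3 - 3 * ?C s1 s4 + ?C s2 s1 + ?C s2 s2 + ?C s2 s3 - 3 * ?C s2 s4
      - 2 * ?C s3 s1 - 2 * ?C s3 s2 - 2 * ?C s3 s3 + 6 * ?C s3 s4"
    unfolding sum_distrib_left sum.distrib[symmetric] sum_subtractf[symmetric]
    by (intro sum.cong refl) (simp add: algebra_simps)
  also have "\<dots> = \<kappa> t * (X s1 s2 + 3 * X s3 s4) - \<kappa> t * (X s1 s3 + X s2 s3 + 3 * X s1 s4 + 3 * X s2 s4) / 2"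
    by (simp only: covariance s deviation_self[OF _ N_pos] deviation_commute[of q N s2 s1]
        deviation_commute[of q N s3 s1] deviation_commute[of q N s3 s2]) (simp add: field_simps)
  also have "\<dots> \<le> \<kappa> t * (X s1 s2 + 3 * X s3 s4)"
    using \<kappa> by (simp add: deviation_nonneg)
  finally show ?thesis .
qed

text \<open>The explicit time dependence of the exponent contributes \<open>D2\<close>, the Gaussian
  one \<open>D4\<close> with two new replicas. For fixed \<open>g\<close> the pairs (1, 2) and (3,
  4) are independent, so the correlation inequality absorbs the product term and
  \<open>D2 g + D4 g \<le> 0\<close> holds pointwise.\<close>

lemma moment_derivative_nonpos:
  assumes \<kappa>: "0 \<le> \<kappa> t"
  shows "\<exists>D \<le> 0. (moment has_real_derivative D) (at t)"
proof -
  define f where "f t = (\<lambda>(s, s'). exp (rate t * X s s'))" for t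
  define f' where "f' t = (\<lambda>(s, s'). - 4 * \<kappa> t * (exp (rate t * X s s') * X s s'))" for t
  \<comment> \<open>The factor 1 + X lets one constant bound the observable and its time derivative
    at all times.\<close>
  define B where "B = (\<Sum>(s, s')\<in>\<Sigma> \<times> \<Sigma>. exp (X s s' / 4) * (1 + X s s'))"
  have B: "exp (X s s' / 4) * (1 + X s s') \<le> B" if "s \<in> \<Sigma>" "s' \<in> \<Sigma>" for s s'
    unfolding B_def using that finite_spin_configs deviation_nonneg
    by (intro member_le_sum[where i="(s, s')" and f="\<lambda>(s, s'). exp (X s s' / 4) * (1 + X s s')", simplified])
      (auto simp: add_nonneg_nonneg)
  have exp_le: "exp (rate t * X s s') \<le> exp (X s s' / 4)" for t s s'
    using mult_right_mono[OF rate_le[of t] deviation_nonneg[of q N s s']] by simp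
  have f_le: "norm (complex_of_real (f t r)) \<le> B" if "r \<in> \<Sigma> \<times> \<Sigma>" for r t
  proof -
    obtain s s' where r: "r = (s, s')" by (cases r)
    have "f t r \<le> exp (X s s' / 4) * (1 + X s s')"
      using exp_le[of t s s'] deviation_nonneg[of q N s s'] mult_mono[OF exp_le[of t s s'], of 1 "1 + X s s'"]
      by (simp add: f_def r)
    also have "\<dots> \<le> B" using that r by (intro B) auto
    finally show ?thesis by (simp add: f_def r)
  qed
  have \<kappa>4: "\<bar>4 * \<kappa> t\<bar> \<le> 1" for t
  proof -
    have "\<bar>\<beta>\<^sup>2 * (sin t * cos t)\<bar> \<le> (1 / 4)\<^sup>2 * (1 * 1)"
      using \<beta>_range unfolding abs_mult by (intro mult_mono) (auto intro!: power_mono)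
    then show ?thesis by (simp add: power2_eq_square mult.assoc abs_mult)
  qed
  have f'_le: "norm (complex_of_real (f' t r)) \<le> B" if "r \<in> \<Sigma> \<times> \<Sigma>" for r t
  proof -
    obtain s s' where r: "r = (s, s')" by (cases r)
    have "\<bar>f' t r\<bar> = \<bar>4 * \<kappa> t\<bar> * (exp (rate t * X s s') * X s s')"
      unfolding f'_def r by (simp add: abs_mult deviation_nonneg)
    also have "\<dots> \<le> 1 * (exp (X s s' / 4) * (1 + X s s'))"
      using deviation_nonneg[of q N s s'] by (intro mult_mono \<kappa>4 exp_le) auto
    also have "\<dots> \<le> B" using that r B by auto
    finally show ?thesis by simp
  qed
  have f_deriv: "((\<lambda>t. complex_of_real (f t r)) has_vector_derivative of_real (f' t r)) (at t)" for r t
  proof (rule has_vector_derivative_of_real)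
    obtain s s' where r: "r = (s, s')" by (cases r)
    show "((\<lambda>t. f t r) has_real_derivative f' t r) (at t)"
      unfolding f_def f'_def r by (auto intro!: derivative_eq_intros rate_deriv)
  qed
  define K where "K = (\<lambda>(((s1, s2), s3), s4). f t (s1, s2) * (\<Sum>k\<in>I. trig k t * trig' k t
    * (a k s1 + a k s2 - 2 * a k s3) * (a k s1 + a k s2 + a k s3 - 3 * a k s4)))"
  let ?G2 = "gibbs (\<Sigma> \<times> \<Sigma>) (adjoin_a a) (adjoin_b b)"
  let ?G4 = "gibbs (((\<Sigma> \<times> \<Sigma>) \<times> \<Sigma>) \<times> \<Sigma>) (adjoin_a (adjoin_a (adjoin_a a))) (adjoin_b (adjoin_b (adjoin_b b)))"
  define D2 where "D2 g = (\<Sum>(s, s')\<in>\<Sigma> \<times> \<Sigma>. weight t g s * weight t g s' * f' t (s, s'))" for g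
  define D4 where "D4 g = (\<Sum>(((s1, s2), s3), s4)\<in>((\<Sigma> \<times> \<Sigma>) \<times> \<Sigma>) \<times> \<Sigma>.
        weight t g s1 * weight t g s2 * (weight t g s3 * weight t g s4) * K (((s1, s2), s3), s4))" for g
  have D2: "?G2 (\<lambda>r. of_real (f' t r)) 2 t = (\<lambda>g. of_real (D2 g))"
    unfolding D2_def by (rule ext) (rule gibbs_two)
  have D4: "?G4 (\<lambda>((r, s), s'). of_real (f t r) * (\<Sum>k\<in>I. of_real (trig k t) * of_real (trig' k t)
      * (of_real (adjoin_a a k r) - 2 * of_real (a k s)) * (of_real (adjoin_a a k r) + of_real (a k s) - (2 + 1) * of_real (a k s')))) (2 + 2) t
      = (\<lambda>g. of_real (D4 g))"
  proof
    fix g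
    have "?G4 (\<lambda>((r, s), s'). of_real (f t r) * (\<Sum>k\<in>I. of_real (trig k t) * of_real (trig' k t)
      * (of_real (adjoin_a a k r) - 2 * of_real (a k s)) * (of_real (adjoin_a a k r) + of_real (a k s) - (2 + 1) * of_real (a k s')))) (2 + 2) t g
      = ?G4 (\<lambda>r. of_real (K r)) 4 t g"
      by (rule trans[OF gibbs_cong]) (auto simp: K_def adjoin_a_def)
    then show "?G4 (\<lambda>((r, s), s'). of_real (f t r) * (\<Sum>k\<in>I. of_real (trig k t) * of_real (trig' k t)
      * (of_real (adjoin_a a k r) - 2 * of_real (a k s)) * (of_real (adjoin_a a k r) + of_real (a k s) - (2 + 1) * of_real (a k s')))) (2 + 2) t g
      = of_real (D4 g)"
      unfolding D4_def by (simp only: gibbs_four)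
  qed
  have "((\<lambda>t. \<integral>g. ?G2 (\<lambda>r. of_real (f t r)) 2 t g \<partial>std_gaussian I) has_vector_derivative
      (\<integral>g. of_real (D2 g) \<partial>std_gaussian I) + (\<integral>g. of_real (D4 g) \<partial>std_gaussian I)) (at t)"
    unfolding D2[symmetric] D4[symmetric]
    using gibbs_interpolation[where p=2 and t=t and f="\<lambda>t r. of_real (f t r)" and f'="\<lambda>t r. of_real (f' t r)",
        OF replicas_two _ f_deriv f_le f'_le] by simp
  moreover have "(\<lambda>t. \<integral>g. ?G2 (\<lambda>r. of_real (f t r)) 2 t g \<partial>std_gaussian I) = (\<lambda>t. of_real (moment t))"
    by (simp only: gibbs_two moment_def f_def case_prod_unfold fst_conv snd_conv integral_complex_of_real)
  ultimately have "((\<lambda>t. complex_of_real (moment t)) has_vector_derivative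
      of_real ((\<integral>g. D2 g \<partial>std_gaussian I) + (\<integral>g. D4 g \<partial>std_gaussian I))) (at t)"
    by simp
  from has_field_derivative_Re[OF this]
  have deriv: "(moment has_real_derivative ((\<integral>g. D2 g \<partial>std_gaussian I) + (\<integral>g. D4 g \<partial>std_gaussian I))) (at t)"
    by simp
  have D2_int: "integrable (std_gaussian I) D2"
    using integrable_Re[OF integrable_gibbs[OF replicas_two, of 2 "\<lambda>r. of_real (f' t r)" t]] by (simp add: D2)
  have "replicas 4 (((\<Sigma> \<times> \<Sigma>) \<times> \<Sigma>) \<times> \<Sigma>) (adjoin_a (adjoin_a (adjoin_a a))) (adjoin_b (adjoin_b (adjoin_b b)))"
    using replicas_adjoin[OF replicas_adjoin[OF replicas_two]] by (simp add: eval_nat_numeral)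
  from integrable_Re[OF integrable_gibbs[OF this, of 4 "\<lambda>r. of_real (K r)" t]]
  have D4_int: "integrable (std_gaussian I) D4"
    by (simp add: gibbs_four D4_def[abs_def])
  have le: "D2 g + D4 g \<le> 0" for g
  proof -
    define u where "u = (\<lambda>(s, s'). weight t g s * weight t g s')"
    define x where "x = (\<lambda>(s, s'). X s s')"
    define T where "T = (\<Sum>r\<in>\<Sigma> \<times> \<Sigma>. u r * (exp (rate t * x r) * x r))"
    define P where "P = (\<Sum>r\<in>\<Sigma> \<times> \<Sigma>. u r * exp (rate t * x r))"
    define Q where "Q = (\<Sum>r\<in>\<Sigma> \<times> \<Sigma>. u r * x r)"
    have u: "0 \<le> u r" for r unfolding u_def by (cases r) (simp add: weight_nonneg)
    have u1: "(\<Sum>r\<in>\<Sigma> \<times> \<Sigma>. u r) = 1"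
      unfolding u_def sum.cartesian_product[symmetric] sum_product[symmetric] by (simp add: sum_weight)
    have "mono (\<lambda>x. exp (rate t * x))"
      using rate_ge[of t] by (auto intro!: monoI mult_left_mono)
    from weighted_chebyshev_sum[OF u u1 this, of x] have PQ: "P * Q \<le> T"
      by (simp add: P_def Q_def T_def)
    \<comment> \<open>After the four-replica estimate each term is a function of (s1, s2) times a
      function of (s3, s4), so the double sum factorizes into \<open>T * 1\<close> and
      \<open>P * Q\<close>.\<close>
    have "D4 g \<le> (\<Sum>(((s1, s2), s3), s4)\<in>((\<Sigma> \<times> \<Sigma>) \<times> \<Sigma>) \<times> \<Sigma>. u (s1, s2) * u (s3, s4) *
        (exp (rate t * x (s1, s2)) * (\<kappa> t * (x (s1, s2) + 3 * x (s3, s4)))))"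
      unfolding D4_def K_def u_def x_def f_def
      using four_replica_bound[OF \<kappa>]
      by (intro sum_mono) (auto intro!: mult_left_mono mult_nonneg_nonneg weight_nonneg)
    also have "\<dots> = (\<Sum>r\<in>\<Sigma> \<times> \<Sigma>. \<Sum>r'\<in>\<Sigma> \<times> \<Sigma>. u r * u r' * (exp (rate t * x r) * (\<kappa> t * (x r + 3 * x r'))))"
      by (simp add: sum.cartesian_product' case_prod_unfold)
    also have "\<dots> = (\<Sum>r\<in>\<Sigma> \<times> \<Sigma>. \<Sum>r'\<in>\<Sigma> \<times> \<Sigma>. \<kappa> t * ((u r * (exp (rate t * x r) * x r)) * u r'
        + 3 * ((u r * exp (rate t * x r)) * (u r' * x r'))))"
      by (intro sum.cong refl) (simp add: algebra_simps)
    also have "\<dots> = \<kappa> t * (T * 1 + 3 * (P * Q))"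
      unfolding sum_distrib_left[symmetric] sum.distrib T_def P_def Q_def u1[symmetric] sum_product ..
    also have "\<dots> \<le> \<kappa> t * (4 * T)"
      using PQ \<kappa> by (intro mult_left_mono) auto
    finally have "D4 g \<le> 4 * \<kappa> t * T" by simp
    moreover have "D2 g = - 4 * \<kappa> t * T"
      unfolding D2_def T_def f'_def u_def x_def sum_distrib_left by (intro sum.cong refl) (auto simp: mult_ac)
    ultimately show ?thesis by simp
  qed
  have "(\<integral>g. D2 g \<partial>std_gaussian I) + (\<integral>g. D4 g \<partial>std_gaussian I) = (\<integral>g. D2 g + D4 g \<partial>std_gaussian I)"
    using D2_int D4_int by simp
  also have "\<dots> \<le> (\<integral>g. 0 \<partial>std_gaussian I)"
    using D2_int D4_int le by (intro integral_mono) auto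
  finally show ?thesis using deriv by auto
qed

lemma moment_le_initial:
  assumes "0 \<le> t" "t \<le> pi / 2"
  shows "moment t \<le> moment 0"
proof (rule DERIV_nonpos_imp_nonincreasing[OF assms(1)])
  fix s assume "0 \<le> s" "s \<le> t"
  then have "0 \<le> \<kappa> s"
    using assms by (intro mult_nonneg_nonneg sin_ge_zero cos_ge_zero) auto
  then show "\<exists>y. (moment has_real_derivative y) (at s) \<and> y \<le> 0"
    using moment_derivative_nonpos by blast
qed

end

section \<open>Independent sites: the overlap moment without pair interaction\<close>

lemma integrable_std_normal_exp: "integrable std_normal_distribution (\<lambda>x. exp (c * x))"
  and integral_std_normal_exp: "(LINT x|std_normal_distribution. exp (c * x)) = exp (c\<^sup>2 / 2)"
proof -
  have eq: "std_normal_density x * exp (c * x) = exp (c\<^sup>2 / 2) * normal_density c 1 x" for x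
    by (simp add: normal_density_def exp_add[symmetric]) (simp add: power2_eq_square field_simps)
  show "integrable std_normal_distribution (\<lambda>x. exp (c * x))"
    by (subst integrable_density) (auto simp: normal_density_nonneg eq)
  show "(LINT x|std_normal_distribution. exp (c * x)) = exp (c\<^sup>2 / 2)"
    by (subst integral_density) (auto simp: normal_density_nonneg eq)
qed

lemma integrable_std_normal_exp_square: "integrable std_normal_distribution (\<lambda>x. exp (x\<^sup>2 / 4))"
  and integral_std_normal_exp_square: "(LINT x|std_normal_distribution. exp (x\<^sup>2 / 4)) = sqrt 2"
proof -
  have eq: "std_normal_density x * exp (x\<^sup>2 / 4) = sqrt 2 * normal_density 0 (sqrt 2) x" for x
    by (simp add: normal_density_def exp_add[symmetric] real_sqrt_mult field_simps)
  show "integrable std_normal_distribution (\<lambda>x. exp (x\<^sup>2 / 4))"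
    by (subst integrable_density) (auto simp: normal_density_nonneg eq)
  show "(LINT x|std_normal_distribution. exp (x\<^sup>2 / 4)) = sqrt 2"
    by (subst integral_density) (auto simp: normal_density_nonneg eq)
qed

text \<open>Hoeffding's lemma for the centered variable with values 1 - q and - (1 + q), taken with
  probabilities (1 + q) / 2 and (1 - q) / 2; the range 2 gives (2 c)^2 / 8. Negative
  \<open>c\<close> is reduced to positive by negating both \<open>c\<close> and \<open>q\<close>,
  which exchanges the two values.\<close>

lemma two_point_subgaussian:
  fixes c q :: real
  assumes "- 1 \<le> q" "q \<le> 1"
  shows "(1 + q) / 2 * exp (c * (1 - q)) + (1 - q) / 2 * exp (- c * (1 + q)) \<le> exp (c\<^sup>2 / 2)"
proof -
  have *: "(1 + q) / 2 * exp (c * (1 - q)) + (1 - q) / 2 * exp (- c * (1 + q)) \<le> exp (c\<^sup>2 / 2)"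
    if c: "0 \<le> c" and q: "- 1 \<le> q" "q \<le> 1" for c q :: real
  proof -
    define p where "p = (1 + q) / 2"
    have p: "0 \<le> p" "p \<le> 1" using q by (auto simp: p_def)
    have pos: "1 + p * (exp (2 * c) - 1) > 0" using p c by (simp add: add_pos_nonneg)
    have "(1 - p) * exp (- (2 * c) * p) + p * (exp (- (2 * c) * p) * exp (2 * c))
        = exp (- (2 * c) * p + ln (1 + p * (exp (2 * c) - 1)))"
      unfolding exp_add exp_ln[OF pos] by (simp add: algebra_simps)
    also have "\<dots> \<le> exp ((2 * c)\<^sup>2 / 8)"
      using Hoeffdings_lemma_aux[of "2 * c" p] c p by simp
    also have "exp (- (2 * c) * p) * exp (2 * c) = exp (c * (1 - q))"
      unfolding exp_add[symmetric] by (simp add: p_def field_simps)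
    also have "- (2 * c) * p = - c * (1 + q)" by (simp add: p_def)
    also have "1 - p = (1 - q) / 2" by (simp add: p_def field_simps)
    also have "(2 * c)\<^sup>2 / 8 = c\<^sup>2 / 2" by (simp add: power2_eq_square)
    finally show ?thesis by (simp only: p_def add.commute)
  qed
  show ?thesis
  proof (cases "0 \<le> c")
    case True
    then show ?thesis using *[OF True assms] by simp
  next
    case False
    then show ?thesis using *[of "- c" "- q"] assms by (simp add: add.commute)
  qed
qed

lemma sum_spin_configs_prod:
  fixes f :: "nat \<Rightarrow> real \<Rightarrow> 'c::comm_semiring_1"
  shows "(\<Sum>\<sigma>\<in>spin_configs N. \<Prod>i=1..N. f i (\<sigma> i)) = (\<Prod>i=1..N. f i (- 1) + f i 1)"
  unfolding spin_configs_def by (subst prod_sum_PiE[symmetric]) auto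

context sk_interpolation
begin

abbreviation site :: "real \<Rightarrow> real" where
  "site z \<equiv> \<beta> * sqrt q * z + h"

lemma energy_zero: "energy a b 0 g \<sigma> = (\<Sum>i=1..N. site (g (Inr i)) * \<sigma> i)"
proof -
  have "energy a b 0 g \<sigma> = (\<Sum>i=1..N. g (Inr i) * (\<beta> * sqrt q * \<sigma> i)) + h * (\<Sum>i=1..N. \<sigma> i)"
    unfolding energy_def unfolding sk_index_def sk_field_def
    by (subst sum.Plus) (auto simp: finite_pairs trig_def sk_coeff_def split: prod.split)
  then show ?thesis by (simp add: sum_distrib_left sum.distrib algebra_simps)
qed

lemma Z_zero: "Z 0 g = (\<Prod>i=1..N. 2 * cosh (site (g (Inr i))))"
proof -
  have cosh2: "2 * cosh x = exp (- x) + exp x" for x :: real by (simp add: cosh_def)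
  show ?thesis
    unfolding Z_def energy_zero cosh2
    by (simp only: exp_sum finite_atLeastAtMost sum_spin_configs_prod[of "\<lambda>i x. exp (site (g (Inr i)) * x)"]
        mult_minus_right mult_1_right)
qed

lemma integral_prod_sites:
  fixes F :: "nat \<Rightarrow> real \<Rightarrow> 'c::{real_normed_field, banach, second_countable_topology}"
  assumes F: "\<And>i. integrable std_normal_distribution (F i)"
  shows "(\<integral>g. (\<Prod>i=1..N. F i (g (Inr i))) \<partial>std_gaussian I) = (\<Prod>i=1..N. integral\<^sup>L std_normal_distribution (F i))"
proof -
  define G where "G k = (case k of Inl _ \<Rightarrow> (\<lambda>_. 1) | Inr i \<Rightarrow> F i)" for k :: "(nat \<times> nat) + nat"
  have "(\<Prod>i=1..N. F i (g (Inr i))) = (\<Prod>k\<in>I. G k (g k))" for g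
    unfolding sk_index_def by (subst prod.Plus) (auto simp: finite_pairs G_def)
  then have "(\<integral>g. (\<Prod>i=1..N. F i (g (Inr i))) \<partial>std_gaussian I) = (\<integral>g. (\<Prod>k\<in>I. G k (g k)) \<partial>std_gaussian I)"
    by simp
  also have "\<dots> = (\<Prod>k\<in>I. integral\<^sup>L std_normal_distribution (G k))"
    by (rule std_normal_product.product_integral_prod[OF finite_sk_index])
      (auto simp: G_def F split: sum.split)
  also have "\<dots> = (\<Prod>i=1..N. integral\<^sup>L std_normal_distribution (F i))"
    unfolding sk_index_def using std_normal.prob_space by (subst prod.Plus) (auto simp: finite_pairs G_def)
  finally show ?thesis .
qed

definition site_weight :: "real \<Rightarrow> real \<Rightarrow> real" where
  "site_weight z x = exp (site z * x) / (2 * cosh (site z))"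

lemma site_weight_bounds:
  assumes "x \<in> {-1, 1}"
  shows "0 \<le> site_weight z x" "site_weight z x \<le> 1"
proof -
  have "0 < exp (site z) + exp (- site z)" by (simp add: add_pos_pos)
  then show "0 \<le> site_weight z x" "site_weight z x \<le> 1"
    using assms by (auto simp: site_weight_def cosh_def)
qed

lemma site_weight_measurable [measurable]: "(\<lambda>z. site_weight z x) \<in> borel_measurable borel"
  unfolding site_weight_def cosh_def by measurable

lemma integrable_site_weight:
  assumes "x \<in> {-1, 1}" "x' \<in> {-1, 1}"
  shows "integrable std_normal_distribution (\<lambda>z. site_weight z x * site_weight z x')"
  using site_weight_bounds[OF assms(1)] site_weight_bounds[OF assms(2)]
  by (intro std_normal.integrable_const_bound[where B=1] AE_I2) (auto simp: abs_mult intro!: mult_le_one)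

text \<open>The joint law of two replicas at one site: they are independent given the field
  \<open>z\<close>, and sharing it is what correlates them.\<close>

definition pair_law :: "real \<Rightarrow> real \<Rightarrow> real" where
  "pair_law x x' = (LINT z|std_normal_distribution. site_weight z x * site_weight z x')"

text \<open>The fixed-point equation is used here: given \<open>z\<close> both spins have mean tanh,
  so they agree with probability (1 + tanh^2) / 2, which averages to (1 + q) / 2. Hence the product
  of the spins has mean exactly \<open>q\<close>.\<close>

lemma pair_law_sums:
  "pair_law 1 1 + pair_law (- 1) (- 1) = (1 + q) / 2"
  "pair_law 1 (- 1) + pair_law (- 1) 1 = (1 - q) / 2"
proof -
  define T where "T z = (tanh (site z))\<^sup>2" for z
  have T_int: "integrable std_normal_distribution T"
  proof (intro std_normal.integrable_const_bound[where B=1] AE_I2)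
    show "norm (T z) \<le> 1" for z
      using tanh_real_bounds[of "site z"] by (auto simp: T_def abs_square_le_1 abs_le_iff)
  qed (simp add: T_def[abs_def] tanh_def sinh_def cosh_def)
  have T_q: "(LINT z|std_normal_distribution. T z) = q"
    unfolding T_def by (rule q_eq[symmetric])
  have T: "site_weight z 1 * site_weight z 1 + site_weight z (- 1) * site_weight z (- 1) = 1 / 2 + T z / 2"
    "site_weight z 1 * site_weight z (- 1) + site_weight z (- 1) * site_weight z 1 = 1 / 2 - T z / 2" for z
  proof -
    define C S where "C = cosh (site z)" and "S = sinh (site z)"
    have C: "C > 0" by (simp add: C_def)
    have "exp (site z) = C + S" "exp (- site z) = C - S"
      by (simp_all add: C_def S_def cosh_plus_sinh cosh_minus_sinh)
    then have w: "site_weight z 1 = (C + S) / (2 * C)" "site_weight z (- 1) = (C - S) / (2 * C)"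
      by (simp_all add: site_weight_def C_def[symmetric])
    have t: "T z = (S / C)\<^sup>2" by (simp add: T_def tanh_def C_def S_def)
    show "site_weight z 1 * site_weight z 1 + site_weight z (- 1) * site_weight z (- 1) = 1 / 2 + T z / 2"
      "site_weight z 1 * site_weight z (- 1) + site_weight z (- 1) * site_weight z 1 = 1 / 2 - T z / 2"
      using C unfolding w t by (simp_all add: power2_eq_square field_simps)
  qed
  have one: "(LINT z|std_normal_distribution. c) = c" for c :: real
    using std_normal.prob_space by simp
  have "pair_law 1 1 + pair_law (- 1) (- 1) = (LINT z|std_normal_distribution. 1 / 2 + T z / 2)"
    unfolding pair_law_def T(1)[symmetric]
    by (rule Bochner_Integration.integral_add[symmetric]) (auto intro: integrable_site_weight)
  also have "\<dots> = 1 / 2 + q / 2"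
    by (subst Bochner_Integration.integral_add) (simp_all only: one T_q integral_divide_zero
        integrable_divide T_int std_normal.integrable_const)
  finally show "pair_law 1 1 + pair_law (- 1) (- 1) = (1 + q) / 2" by (simp add: add_divide_distrib)
  have "pair_law 1 (- 1) + pair_law (- 1) 1 = (LINT z|std_normal_distribution. 1 / 2 - T z / 2)"
    unfolding pair_law_def T(2)[symmetric]
    by (rule Bochner_Integration.integral_add[symmetric]) (auto intro: integrable_site_weight)
  also have "\<dots> = 1 / 2 - q / 2"
    by (subst Bochner_Integration.integral_diff) (simp_all only: one T_q integral_divide_zero
        integrable_divide T_int std_normal.integrable_const)
  finally show "pair_law 1 (- 1) + pair_law (- 1) 1 = (1 - q) / 2" by (simp add: diff_divide_distrib)
qed

lemma spin_values: "\<sigma> \<in> \<Sigma> \<Longrightarrow> i \<in> {1..N} \<Longrightarrow> \<sigma> i \<in> {-1, 1}"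
  unfolding spin_configs_def by (rule PiE_mem)

lemma weight_zero: "weight 0 g \<sigma> = (\<Prod>i=1..N. site_weight (g (Inr i)) (\<sigma> i))"
  unfolding weight_def energy_zero Z_zero site_weight_def by (simp add: exp_sum prod_dividef)

lemma integral_weight_zero:
  assumes "\<sigma> \<in> \<Sigma>" "\<tau> \<in> \<Sigma>"
  shows "(\<integral>g. weight 0 g \<sigma> * weight 0 g \<tau> \<partial>std_gaussian I) = (\<Prod>i=1..N. pair_law (\<sigma> i) (\<tau> i))"
proof -
  \<comment> \<open>\<open>integral_prod_sites\<close> asks for integrability at every index, so the
    factors outside \<open>{1..N}\<close> are set to 0.\<close>
  define F where "F i = (if i \<in> {1..N} then (\<lambda>z. site_weight z (\<sigma> i) * site_weight z (\<tau> i)) else (\<lambda>_. 0))" for i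
  have "integrable std_normal_distribution (F i)" for i
    unfolding F_def using spin_values assms by (auto intro!: integrable_site_weight)
  from integral_prod_sites[OF this]
  have "(\<integral>g. (\<Prod>i=1..N. F i (g (Inr i))) \<partial>std_gaussian I) = (\<Prod>i=1..N. integral\<^sup>L std_normal_distribution (F i))" .
  also have "\<dots> = (\<Prod>i=1..N. pair_law (\<sigma> i) (\<tau> i))"
    by (intro prod.cong) (auto simp: F_def pair_law_def)
  also have "(\<lambda>g. \<Prod>i=1..N. F i (g (Inr i))) = (\<lambda>g. weight 0 g \<sigma> * weight 0 g \<tau>)"
    unfolding weight_zero prod.distrib[symmetric] by (intro ext prod.cong) (auto simp: F_def)
  finally show ?thesis .
qed

lemma weight_measurable [measurable]: "(\<lambda>g. weight t g \<sigma>) \<in> borel_measurable (std_gaussian I)"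
  unfolding weight_def Z_def energy_def by measurable

lemma weight_le_one: "\<sigma> \<in> \<Sigma> \<Longrightarrow> weight t g \<sigma> \<le> 1"
  unfolding sum_weight[of t g, symmetric] by (intro member_le_sum) (auto simp: weight_nonneg finite_spin_configs)

lemma integrable_weights:
  assumes "\<sigma> \<in> \<Sigma>" "\<tau> \<in> \<Sigma>"
  shows "integrable (std_gaussian I) (\<lambda>g. weight t g \<sigma> * weight t g \<tau> * c)"
  by (intro integrable_mult_left integrable_bounded_std_gaussian[where C=1])
    (auto simp: abs_mult weight_nonneg assms weight_le_one intro!: mult_le_one)

text \<open>
  Without the pair interaction the products \<open>\<sigma>\<^sub>i \<tau>\<^sub>i\<close> are independent with mean \<open>q\<close> under the
  averaged Gibbs measure; the square in the exponent is linearized by a Gaussian integral.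
\<close>

lemma moment_zero_le: "moment 0 \<le> sqrt 2"
proof -
  define V where "V = (\<lambda>(\<sigma>, \<tau>). \<Prod>i=1..N. pair_law (\<sigma> i) (\<tau> i))"
  define D where "D = (\<lambda>(\<sigma>, \<tau>). \<Sum>i=1..N. \<sigma> i * \<tau> i - q)"
  let ?s = "sqrt (2 * real N)"
  have s: "?s > 0" using N_pos by simp
  \<comment> \<open>\<open>rate 0 = 1 / 4\<close> makes the exponent D^2 / (4 N), half the square of
    D / sqrt (2 N), hence an exponential moment of a normal variable. Given \<xi>, the new exponent
    is additive over the sites.\<close>
  have expX: "exp (rate 0 * X \<sigma> \<tau>) = (LINT \<xi>|std_normal_distribution. exp (D (\<sigma>, \<tau>) / ?s * \<xi>))" for \<sigma> \<tau>
    unfolding integral_std_normal_exp by (simp add: rate_def deviation_def D_def power_divide)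
  have "moment 0 = (\<Sum>(\<sigma>, \<tau>)\<in>\<Sigma> \<times> \<Sigma>. \<integral>g. weight 0 g \<sigma> * weight 0 g \<tau> * exp (rate 0 * X \<sigma> \<tau>) \<partial>std_gaussian I)"
    unfolding moment_def case_prod_unfold
    by (rule Bochner_Integration.integral_sum) (intro integrable_weights, auto)
  also have "\<dots> = (\<Sum>r\<in>\<Sigma> \<times> \<Sigma>. V r * (LINT \<xi>|std_normal_distribution. exp (D r / ?s * \<xi>)))"
    by (intro sum.cong refl) (auto simp: integral_weight_zero V_def expX)
  also have "\<dots> = (LINT \<xi>|std_normal_distribution. (\<Sum>r\<in>\<Sigma> \<times> \<Sigma>. V r * exp (D r / ?s * \<xi>)))"
    by (subst Bochner_Integration.integral_sum)
      (intro integrable_mult_right integrable_std_normal_exp, simp)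
  also have "\<dots> \<le> (LINT \<xi>|std_normal_distribution. exp (\<xi>\<^sup>2 / 4))"
  proof (rule integral_mono)
    fix \<xi> :: real
    define c where "c = \<xi> / ?s"
    define w where "w x x' = pair_law x x' * exp (c * (x * x' - q))" for x x'
    have "(\<Sum>r\<in>\<Sigma> \<times> \<Sigma>. V r * exp (D r / ?s * \<xi>)) = (\<Sum>\<sigma>\<in>\<Sigma>. \<Sum>\<tau>\<in>\<Sigma>. \<Prod>i=1..N. w (\<sigma> i) (\<tau> i))"
    proof -
      have "D (\<sigma>, \<tau>) / ?s * \<xi> = (\<Sum>i=1..N. c * (\<sigma> i * \<tau> i - q))" for \<sigma> \<tau>
        unfolding D_def sum_distrib_left[symmetric] by (simp add: c_def)
      then show ?thesis
        unfolding sum.cartesian_product V_def w_def prod.distrib by (intro sum.cong refl) (auto simp: exp_sum)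
    qed
    also have "\<dots> = (\<Prod>i=1..N. (w (- 1) (- 1) + w (- 1) 1) + (w 1 (- 1) + w 1 1))"
      unfolding sum_spin_configs_prod[of "\<lambda>i x'. w (\<sigma> i) x'" for \<sigma>]
      by (rule sum_spin_configs_prod[of "\<lambda>i x. w x (- 1) + w x 1"])
    also have "(w (- 1) (- 1) + w (- 1) 1) + (w 1 (- 1) + w 1 1)
        = (pair_law 1 1 + pair_law (- 1) (- 1)) * exp (c * (1 - q))
          + (pair_law 1 (- 1) + pair_law (- 1) 1) * exp (- c * (1 + q))"
      by (simp add: w_def algebra_simps)
    \<comment> \<open>Each site costs at most exp (c^2 / 2); with c = \<xi> / sqrt (2 N) the N sites
      together give exp (\<xi>^2 / 4), free of N and still integrable.\<close>
    also have "(\<Prod>i=1..N. \<dots>) \<le> exp (c\<^sup>2 / 2) ^ N"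
      unfolding pair_law_sums using two_point_subgaussian[of q c] q_range by (auto intro!: power_mono)
    also have "\<dots> = exp (\<xi>\<^sup>2 / 4)"
      using N_pos by (simp add: exp_of_nat_mult[symmetric] c_def power_divide)
    finally show "(\<Sum>r\<in>\<Sigma> \<times> \<Sigma>. V r * exp (D r / ?s * \<xi>)) \<le> exp (\<xi>\<^sup>2 / 4)" .
  qed (intro Bochner_Integration.integrable_sum integrable_mult_right integrable_std_normal_exp
      integrable_std_normal_exp_square)+
  also have "\<dots> = sqrt 2" by (rule integral_std_normal_exp_square)
  finally show ?thesis .
qed

lemma integrable_overlap:
  "integrable (std_gaussian I) (\<lambda>g. \<Sum>(\<sigma>, \<tau>)\<in>\<Sigma> \<times> \<Sigma>. weight t g \<sigma> * weight t g \<tau> * F \<sigma> \<tau>)"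
  unfolding case_prod_unfold by (intro Bochner_Integration.integrable_sum integrable_weights) auto

text \<open>Apply x \<le> exp x to an eighth of the deviation, which the lower bound on
  \<open>rate\<close> permits at all times. The moment is at most sqrt 2 < 2, whence 8 * 2.\<close>

lemma overlap_bound:
  assumes "0 \<le> t" "t \<le> pi / 2"
  shows "(\<integral>g. (\<Sum>(\<sigma>, \<tau>)\<in>\<Sigma> \<times> \<Sigma>. weight t g \<sigma> * weight t g \<tau> * X \<sigma> \<tau>) \<partial>std_gaussian I) \<le> 16"
proof -
  have X_le: "X \<sigma> \<tau> \<le> 8 * exp (rate t * X \<sigma> \<tau>)" for \<sigma> \<tau>
  proof -
    have "X \<sigma> \<tau> / 8 \<le> exp (X \<sigma> \<tau> / 8)" using exp_ge_add_one_self[of "X \<sigma> \<tau> / 8"] by linarith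
    also have "\<dots> \<le> exp (rate t * X \<sigma> \<tau>)"
      using mult_right_mono[OF rate_ge[of t] deviation_nonneg[of q N \<sigma> \<tau>]] by simp
    finally show ?thesis by simp
  qed
  have "(\<integral>g. (\<Sum>(\<sigma>, \<tau>)\<in>\<Sigma> \<times> \<Sigma>. weight t g \<sigma> * weight t g \<tau> * X \<sigma> \<tau>) \<partial>std_gaussian I)
      \<le> (\<integral>g. 8 * (\<Sum>(\<sigma>, \<tau>)\<in>\<Sigma> \<times> \<Sigma>. weight t g \<sigma> * weight t g \<tau> * exp (rate t * X \<sigma> \<tau>)) \<partial>std_gaussian I)"
  proof (rule integral_mono[OF integrable_overlap integrable_mult_right[OF integrable_overlap]])
    fix g
    show "(\<Sum>(\<sigma>, \<tau>)\<in>\<Sigma> \<times> \<Sigma>. weight t g \<sigma> * weight t g \<tau> * X \<sigma> \<tau>)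
        \<le> 8 * (\<Sum>(\<sigma>, \<tau>)\<in>\<Sigma> \<times> \<Sigma>. weight t g \<sigma> * weight t g \<tau> * exp (rate t * X \<sigma> \<tau>))"
      unfolding sum_distrib_left
      using mult_left_mono[OF X_le, of "weight t g \<sigma> * weight t g \<tau>" for \<sigma> \<tau>]
      by (intro sum_mono) (auto simp: weight_nonneg algebra_simps)
  qed
  also have "\<dots> = 8 * moment t" by (simp add: moment_def)
  also have "moment t \<le> 2"
    using moment_le_initial[OF assms] moment_zero_le sqrt2_less_2 by linarith
  finally show ?thesis by simp
qed

end

section \<open>The characteristic function of log Z along the interpolation\<close>

context sk_interpolation
begin

lemma gibbs_one:
  assumes "replicas n A a' b'"
  shows "gibbs A a' b' (\<lambda>_. 1) (p + of_nat n) t g = exp (- p * of_real (ln (Z t g)))"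
proof -
  have "(\<Sum>r\<in>A. exp (complex_of_real (energy a' b' t g r))) = of_real (\<Sum>r\<in>A. exp (energy a' b' t g r))"
    by (simp add: exp_of_real)
  also have "\<dots> = of_real (Z t g ^ n)" using assms by (simp add: replicas_def)
  finally have "gibbs A a' b' (\<lambda>_. 1) (p + of_nat n) t g
      = of_real (Z t g ^ n) * (exp (- of_nat n * of_real (ln (Z t g))) * exp (- p * of_real (ln (Z t g))))"
    by (simp add: gibbs_def exp_add[symmetric] algebra_simps)
  also have "\<dots> = exp (- p * of_real (ln (Z t g)))"
    unfolding exp_nat_ln_Z using Z_pos[of t g] by simp
  finally show ?thesis .
qed

definition char_log_Z :: "real \<Rightarrow> real \<Rightarrow> complex" where
  "char_log_Z u t = (\<integral>g. iexp (u * ln (Z t g)) \<partial>std_gaussian I)"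

text \<open>Up to the factor \<open>\<kappa> t\<close>, the logarithmic derivative that would hold
  if the overlap of two replicas were exactly \<open>q\<close>. For u = s / sqrt N its imaginary
  part, of order sqrt N, only recenters; its real part tends to s^2 q^2 / 2 and produces the
  negative term of the limit variance.\<close>

definition drift :: "real \<Rightarrow> complex" where
  "drift u = \<i> * u * (real N * (1 - q)\<^sup>2 / 2) + u\<^sup>2 * ((real N * q\<^sup>2 + 1) / 2)"

lemma char_log_Z_deriv:
  assumes t: "0 \<le> t" "t \<le> pi / 2"
  shows "\<exists>R. norm R \<le> 8 * (\<bar>u\<bar> * (1 + \<bar>u\<bar>)) \<and>
    (char_log_Z u has_vector_derivative \<kappa> t * (drift u * char_log_Z u t + R)) (at t)"
proof -
  define p :: complex where "p = - \<i> * u"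
  have p0: "Re p = real 0" by (simp add: p_def)
  \<comment> \<open>The interpolation starts without replicas: on the one-point system of zero
    energy the Gibbs average with exponent \<open>p\<close> is Z^(\<i>u) itself. Both replicas of
    the overlap are created by the formula.\<close>
  have rep0: "replicas 0 {()} (\<lambda>_ _. 0) (\<lambda>_. 0)" by (rule replicas_zero)
  note rep2 = replicas_adjoin[OF replicas_adjoin[OF rep0]]
  let ?A = "({()} \<times> \<Sigma>) \<times> \<Sigma>"
  let ?a = "adjoin_a (adjoin_a (\<lambda>_ _. 0))" and ?b = "adjoin_b (adjoin_b (\<lambda>_. 0))"
  let ?G0 = "gibbs {()} (\<lambda>_ _. 0) (\<lambda>_. 0)" and ?G2 = "gibbs ?A ?a ?b"
  have G0: "?G0 (\<lambda>_. 1) p t g = iexp (u * ln (Z t g))" for t g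
    using gibbs_one[OF rep0, of p t g] by (simp add: p_def mult.assoc)
  have G2: "?G2 (\<lambda>_. 1) (p + 2) t g = iexp (u * ln (Z t g))" for g
    using gibbs_one[OF rep2, of p t g] by (simp add: p_def eval_nat_numeral mult.assoc)
  define V where "V = (\<lambda>((r :: unit, s), s'). complex_of_real (X s s'))"
  define R where "R = p * (p + 1) / 2 * (\<integral>g. ?G2 V (p + 2) t g \<partial>std_gaussian I)"
  \<comment> \<open>The constant part of the covariance collects p - p (p + 1) = - p^2, while the
    deviation keeps p (p + 1) / 2, which is small with \<open>u\<close>.\<close>
  have K: "(\<Sum>k\<in>I. of_real (trig k t) * of_real (trig' k t) * (0 - p * of_real (a k s))
        * (0 + of_real (a k s) - (p + 1) * of_real (a k s')))
      = of_real (\<kappa> t) * (drift u + p * (p + 1) / 2 * of_real (X s s'))" if s: "s \<in> \<Sigma>" "s' \<in> \<Sigma>" for s s'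
  proof -
    let ?C = "\<lambda>s s'. \<Sum>k\<in>I. trig k t * trig' k t * (a k s * a k s')"
    have "(\<Sum>k\<in>I. of_real (trig k t) * of_real (trig' k t) * (0 - p * of_real (a k s))
        * (0 + of_real (a k s) - (p + 1) * of_real (a k s')))
      = - p * (of_real (?C s s) - (p + 1) * of_real (?C s s'))"
      unfolding of_real_sum sum_distrib_left sum_subtractf[symmetric]
      by (intro sum.cong refl) (simp add: algebra_simps)
    also have "\<dots> = of_real (\<kappa> t) * (drift u + p * (p + 1) / 2 * of_real (X s s'))"
    proof -
      have p2: "p * p = - (of_real u * of_real u)" by (simp add: p_def complex_eq_iff)
      have d: "drift u = - p * (real N * (1 - q)\<^sup>2 / 2) - p * p * ((real N * q\<^sup>2 + 1) / 2)"
        unfolding p2 by (simp add: drift_def p_def power2_eq_square)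
      show ?thesis
        unfolding covariance[OF s] covariance[OF s(1) s(1)] deviation_self[OF s(1) N_pos] d
        by (simp add: field_simps)
    qed
    finally show ?thesis .
  qed
  define W where "W = (\<lambda>((r :: unit, s), s'). 1 * (\<Sum>k\<in>I. of_real (trig k t) * of_real (trig' k t)
    * (of_real 0 - p * of_real (a k s)) * (of_real 0 + of_real (a k s) - (p + 1) * of_real (a k s'))))"
  have d1: "((\<lambda>t. \<integral>g. ?G0 (\<lambda>_. 1) p t g \<partial>std_gaussian I) has_vector_derivative
      (\<integral>g. ?G2 W (p + 2) t g \<partial>std_gaussian I)) (at t)"
    using gibbs_interpolation[where f="\<lambda>_ _. 1" and f'="\<lambda>_ _. 0" and C=1 and t=t, OF rep0 p0]
    by (simp add: W_def gibbs_def[of "{()}" _ _ "\<lambda>_. 0"])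
  have d2: "?G2 W (p + 2) t g
      = \<kappa> t * (drift u * iexp (u * ln (Z t g)) + p * (p + 1) / 2 * ?G2 V (p + 2) t g)" for g
  proof -
    have "?G2 W (p + 2) t g = ?G2 (\<lambda>r. of_real (\<kappa> t) * (drift u * 1 + p * (p + 1) / 2 * V r)) (p + 2) t g"
      unfolding W_def using K by (intro gibbs_cong) (auto simp: V_def)
    then show ?thesis unfolding gibbs_cmult gibbs_add G2 by simp
  qed
  have int1: "integrable (std_gaussian I) (\<lambda>g. iexp (u * ln (Z t g)))"
    unfolding G0[symmetric] by (rule integrable_gibbs[OF rep0 p0])
  have int2: "integrable (std_gaussian I) (?G2 V (p + 2) t)"
    by (rule integrable_gibbs[OF rep2]) (simp add: p_def)
  have d3: "(\<integral>g. ?G2 W (p + 2) t g \<partial>std_gaussian I) = \<kappa> t * (drift u * char_log_Z u t + R)"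
    unfolding d2 R_def char_log_Z_def
    by (simp only: integral_mult_right_zero
        Bochner_Integration.integral_add[OF integrable_mult_right[OF int1] integrable_mult_right[OF int2]])
  have deriv: "(char_log_Z u has_vector_derivative \<kappa> t * (drift u * char_log_Z u t + R)) (at t)"
    using d1 unfolding d3 G0 char_log_Z_def[symmetric] .
  \<comment> \<open>An imaginary power of \<open>Z\<close> has modulus one, so the complex average
    is dominated by the true Gibbs average of the deviation.\<close>
  have V_le: "norm (?G2 V (p + 2) t g) \<le> (\<Sum>(s, s')\<in>\<Sigma> \<times> \<Sigma>. weight t g s * weight t g s' * X s s')" for g
  proof -
    have "norm (exp (- (p + 2) * complex_of_real (ln (Z t g)))) = norm (exp (- (of_nat 2 :: complex) * of_real (ln (Z t g))))"
      by (simp add: p_def)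
    also have "\<dots> = inverse (Z t g ^ 2)"
      unfolding exp_nat_ln_Z using Z_pos[of t g] by (simp add: norm_inverse norm_power)
    finally have n: "norm (exp (- (p + 2) * complex_of_real (ln (Z t g)))) = inverse (Z t g ^ 2)" .
    have "norm (?G2 V (p + 2) t g) \<le> (\<Sum>r\<in>?A. norm (V r * exp (of_real (energy ?a ?b t g r)))) * inverse (Z t g ^ 2)"
      unfolding gibbs_def norm_mult n by (intro mult_right_mono) (auto intro!: order_trans[OF norm_sum] simp: norm_mult)
    also have "\<dots> = (\<Sum>(s, s')\<in>\<Sigma> \<times> \<Sigma>. weight t g s * weight t g s' * X s s')"
      by (simp add: sum.cartesian_product' V_def norm_mult energy_adjoin' deviation_nonneg sum_distrib_right sum_distrib_left
          weight_def power2_eq_square divide_inverse mult_ac exp_add)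
        (simp add: energy_def)
    finally show ?thesis .
  qed
  have "norm (\<integral>g. ?G2 V (p + 2) t g \<partial>std_gaussian I) \<le> (\<integral>g. norm (?G2 V (p + 2) t g) \<partial>std_gaussian I)"
    by (rule integral_norm_bound)
  also have "\<dots> \<le> (\<integral>g. (\<Sum>(s, s')\<in>\<Sigma> \<times> \<Sigma>. weight t g s * weight t g s' * X s s') \<partial>std_gaussian I)"
    by (intro integral_mono integrable_norm int2 integrable_overlap V_le)
  also have "\<dots> \<le> 16" by (rule overlap_bound[OF t])
  finally have i16: "norm (\<integral>g. ?G2 V (p + 2) t g \<partial>std_gaussian I) \<le> 16" .
  have np: "norm p = \<bar>u\<bar>" by (simp add: p_def norm_mult)
  have np1: "norm (p + 1) \<le> 1 + \<bar>u\<bar>" using norm_triangle_ineq[of p 1] np by simp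
  have "norm R = (\<bar>u\<bar> * norm (p + 1)) / 2 * norm (\<integral>g. ?G2 V (p + 2) t g \<partial>std_gaussian I)"
    by (simp add: R_def norm_mult norm_divide np)
  also have "\<dots> \<le> (\<bar>u\<bar> * (1 + \<bar>u\<bar>)) / 2 * 16"
    by (intro mult_mono divide_right_mono i16 np1) auto
  finally show ?thesis using deriv by (intro exI[of _ R]) simp
qed

text \<open>\<open>E\<close> is an integrating factor, built from the integral of
  \<open>\<kappa>\<close>, which is \<beta>^2 / 2 over the whole path. The drift has nonnegative
  real part, so \<open>E\<close> has modulus at most 1 and does not amplify the error; the path
  length pi / 2 < 2 turns 8 into 16.\<close>

lemma char_log_Z_endpoints:
  "norm (char_log_Z u (pi / 2) * exp (- (\<beta>\<^sup>2 / 2) * drift u) - char_log_Z u 0) \<le> 16 * (\<bar>u\<bar> * (1 + \<bar>u\<bar>))"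
proof -
  define E where "E t = exp (- (\<beta>\<^sup>2 * (sin t)\<^sup>2 / 2) * drift u)" for t
  define \<psi> where "\<psi> t = char_log_Z u t * E t" for t
  have dE: "(E has_vector_derivative - \<kappa> t * drift u * E t) (at t)" for t
  proof -
    have "((\<lambda>t. - (\<beta>\<^sup>2 * (sin t)\<^sup>2 / 2)) has_real_derivative - \<kappa> t) (at t)"
      by (auto intro!: derivative_eq_intros)
    from has_vector_derivative_mult_left[OF has_vector_derivative_of_real[OF this], of "drift u"]
    have d: "((\<lambda>t. of_real (- (\<beta>\<^sup>2 * (sin t)\<^sup>2 / 2)) * drift u) has_vector_derivative of_real (- \<kappa> t) * drift u) (at t)" .
    have "((\<lambda>t. exp (of_real (- (\<beta>\<^sup>2 * (sin t)\<^sup>2 / 2)) * drift u)) has_vector_derivative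
        of_real (- \<kappa> t) * drift u * exp (of_real (- (\<beta>\<^sup>2 * (sin t)\<^sup>2 / 2)) * drift u)) (at t)"
      by (rule field_vector_diff_chain_at[OF d DERIV_exp, unfolded o_def])
    then show ?thesis by (simp add: E_def[abs_def])
  qed
  have "Re (drift u) \<ge> 0" by (simp add: drift_def)
  then have E_le: "norm (E t) \<le> 1" for t
    by (simp add: E_def)
  have \<kappa>_le: "\<bar>\<kappa> t\<bar> \<le> 1" for t
  proof -
    have "\<beta>\<^sup>2 \<le> 1" using \<beta>_range by (intro power_le_one) auto
    then have "\<bar>\<beta>\<^sup>2 * (sin t * cos t)\<bar> \<le> 1 * (1 * 1)"
      unfolding abs_mult by (intro mult_mono) auto
    then show ?thesis by (simp add: mult.assoc)
  qed
  have "\<exists>D. norm D \<le> 8 * (\<bar>u\<bar> * (1 + \<bar>u\<bar>)) \<and> (\<psi> has_vector_derivative D) (at t)" if t: "0 \<le> t" "t \<le> pi / 2" for t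
  proof -
    obtain R where R: "norm R \<le> 8 * (\<bar>u\<bar> * (1 + \<bar>u\<bar>))"
      and d: "(char_log_Z u has_vector_derivative \<kappa> t * (drift u * char_log_Z u t + R)) (at t)"
      using char_log_Z_deriv[OF t] by blast
    have "(\<psi> has_vector_derivative \<kappa> t * R * E t) (at t)"
      unfolding \<psi>_def by (rule has_vector_derivative_eq_rhs[OF has_vector_derivative_mult[OF d dE]])
        (simp add: algebra_simps)
    moreover have "norm (\<kappa> t * R * E t) \<le> 1 * (8 * (\<bar>u\<bar> * (1 + \<bar>u\<bar>))) * 1"
      unfolding norm_mult[of _ "E t"] norm_mult[of _ R] norm_of_real
      by (intro mult_mono R E_le \<kappa>_le) auto
    ultimately show ?thesis by auto
  qed
  then obtain D where D: "\<And>t. 0 \<le> t \<Longrightarrow> t \<le> pi / 2 \<Longrightarrow> norm (D t) \<le> 8 * (\<bar>u\<bar> * (1 + \<bar>u\<bar>))"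
    "\<And>t. 0 \<le> t \<Longrightarrow> t \<le> pi / 2 \<Longrightarrow> (\<psi> has_vector_derivative D t) (at t)" by metis
  have "norm (\<psi> (pi / 2) - \<psi> 0) \<le> 8 * (\<bar>u\<bar> * (1 + \<bar>u\<bar>)) * norm (pi / 2 - 0)"
  proof (rule differentiable_bound[where S="{0..pi / 2}" and f'="\<lambda>t h. h *\<^sub>R D t"])
    fix t assume t: "t \<in> {0..pi / 2}"
    show "(\<psi> has_derivative (\<lambda>h. h *\<^sub>R D t)) (at t within {0..pi / 2})"
      using D(2)[of t] t unfolding has_vector_derivative_def by (auto intro: has_derivative_at_withinI)
    show "onorm (\<lambda>h. h *\<^sub>R D t) \<le> 8 * (\<bar>u\<bar> * (1 + \<bar>u\<bar>))"
      using mult_left_mono[OF D(1)[of t]] t by (intro onorm_le) (auto simp: mult.commute)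
  qed auto
  also have "\<dots> \<le> 8 * (\<bar>u\<bar> * (1 + \<bar>u\<bar>)) * 2"
    using pi_less_4 by (intro mult_left_mono) auto
  finally show ?thesis by (simp add: \<psi>_def E_def)
qed

lemma char_log_Z_zero:
  "char_log_Z u 0 = (CLINT z|std_normal_distribution. iexp (u * ln (2 * cosh (site z)))) ^ N"
proof -
  have "iexp (u * ln (Z 0 g)) = (\<Prod>i=1..N. iexp (u * ln (2 * cosh (site (g (Inr i))))))" for g
  proof -
    have "ln (Z 0 g) = (\<Sum>i=1..N. ln (2 * cosh (site (g (Inr i)))))"
      unfolding Z_zero by (rule ln_prod) auto
    then show ?thesis
      by (simp add: exp_sum[symmetric] sum_distrib_left)
  qed
  then have "char_log_Z u 0 = (\<integral>g. (\<Prod>i=1..N. iexp (u * ln (2 * cosh (site (g (Inr i)))))) \<partial>std_gaussian I)"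
    by (simp add: char_log_Z_def)
  also have "\<dots> = (\<Prod>i=1..N. (CLINT z|std_normal_distribution. iexp (u * ln (2 * cosh (site z)))))"
    by (rule integral_prod_sites, rule std_normal.integrable_const_bound[where B=1]) (auto simp: cosh_def)
  finally show ?thesis by simp
qed

end

section \<open>The Gaussian limit\<close>

text \<open>The second-order expansion has error s^2 / n times a truncated third moment, which
  vanishes by dominated convergence with 6 x^2, so two moments suffice. The powers differ by at most
  n times the difference of their bases, provided both bases lie in the unit disc.\<close>

lemma (in real_distribution) char_power_limit:
  assumes int1: "integrable M (\<lambda>x. x)" and mean: "expectation (\<lambda>x. x) = 0"
    and int2: "integrable M (\<lambda>x. x\<^sup>2)" and var: "variance (\<lambda>x. x) = v"
  shows "(\<lambda>n. char M (s / sqrt (real n)) ^ n) \<longlonglongrightarrow> of_real (exp (- (s\<^sup>2 * v / 2)))"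
proof -
  define e where "e n = expectation (\<lambda>x. min (6 * x\<^sup>2) (\<bar>s / sqrt (real n)\<bar> * \<bar>x\<bar> ^ 3))" for n
  have v: "0 \<le> v" unfolding var[symmetric] by (rule Bochner_Integration.integral_nonneg) simp
  have main: "\<forall>\<^sub>F n in sequentially.
      norm (char M (s / sqrt (real n)) ^ n - complex_of_real ((1 + (- (s\<^sup>2 * v / 2)) / real n) ^ n)) \<le> s\<^sup>2 / 6 * e n"
  proof (rule eventually_sequentiallyI)
    \<comment> \<open>The threshold s^2 v / 4 keeps 1 - s^2 v / (2 n) above -1, hence in the unit
      disc.\<close>
    fix n :: nat assume n: "n \<ge> max 1 (nat \<lceil>s\<^sup>2 * v / 4\<rceil>)"
    then have n1: "n \<ge> 1" and n2: "s\<^sup>2 * v / 4 \<le> real n" by (auto simp: nat_ceiling_le_eq)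
    let ?t = "s / sqrt (real n)"
    have t2: "?t\<^sup>2 = s\<^sup>2 / n" using n1 by (simp add: power_divide)
    have b: "norm (char M ?t - (1 + (- (s\<^sup>2 * v / 2)) / real n)) \<le> s\<^sup>2 / n / 6 * e n"
      using char_approx3[OF int1 mean int2 var, of ?t] unfolding t2 e_def by (simp add: field_simps)
    have "norm (char M ?t ^ n - complex_of_real (1 + (- (s\<^sup>2 * v / 2)) / real n) ^ n)
        \<le> real n * norm (char M ?t - complex_of_real (1 + (- (s\<^sup>2 * v / 2)) / real n))"
    proof (rule norm_power_diff)
      have "\<bar>1 + (- (s\<^sup>2 * v / 2)) / real n\<bar> \<le> 1"
        using n1 n2 v by (auto simp: abs_le_iff field_simps)
      then show "norm (complex_of_real (1 + (- (s\<^sup>2 * v / 2)) / real n)) \<le> 1"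
        unfolding norm_of_real .
    qed (rule cmod_char_le_1)
    also have "\<dots> \<le> real n * (s\<^sup>2 / n / 6 * e n)" using b by (intro mult_left_mono) auto
    also have "\<dots> = s\<^sup>2 / 6 * e n" using n1 by simp
    finally show "norm (char M ?t ^ n - complex_of_real ((1 + (- (s\<^sup>2 * v / 2)) / real n) ^ n)) \<le> s\<^sup>2 / 6 * e n"
      by simp
  qed
  have "e \<longlonglongrightarrow> expectation (\<lambda>_. 0)"
    unfolding e_def
  proof (rule integral_dominated_convergence[where w="\<lambda>x. 6 * x\<^sup>2"])
    show "AE x in M. (\<lambda>n. min (6 * x\<^sup>2) (\<bar>s / sqrt (real n)\<bar> * \<bar>x\<bar> ^ 3)) \<longlonglongrightarrow> 0"
    proof (rule AE_I2)
      fix x :: real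
      have "(\<lambda>n. \<bar>s / sqrt (real n)\<bar> * \<bar>x\<bar> ^ 3) \<longlonglongrightarrow> 0"
      proof -
        have "(\<lambda>n. 1 / sqrt (real n)) \<longlonglongrightarrow> 0" by real_asymp
        from tendsto_mult_left_zero[OF tendsto_mult_right_zero[OF this]] show ?thesis
          by (simp add: abs_divide)
      qed
      then have "(\<lambda>n. min (6 * x\<^sup>2) (\<bar>s / sqrt (real n)\<bar> * \<bar>x\<bar> ^ 3)) \<longlonglongrightarrow> min (6 * x\<^sup>2) 0"
        by (intro tendsto_min tendsto_const)
      then show "(\<lambda>n. min (6 * x\<^sup>2) (\<bar>s / sqrt (real n)\<bar> * \<bar>x\<bar> ^ 3)) \<longlonglongrightarrow> 0" by (simp add: min_absorb2)
    qed
  qed (use int2 in auto)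
  then have "(\<lambda>n. s\<^sup>2 / 6 * e n) \<longlonglongrightarrow> s\<^sup>2 / 6 * 0" by (intro tendsto_mult_left) simp
  then have z: "(\<lambda>n. char M (s / sqrt (real n)) ^ n - complex_of_real ((1 + (- (s\<^sup>2 * v / 2)) / real n) ^ n)) \<longlonglongrightarrow> 0"
    by (intro Lim_null_comparison[OF main]) simp
  have "(\<lambda>n. complex_of_real ((1 + (- (s\<^sup>2 * v / 2)) / real n) ^ n)) \<longlonglongrightarrow> of_real (exp (- (s\<^sup>2 * v / 2)))"
    by (intro tendsto_of_real tendsto_exp_limit_sequentially)
  from tendsto_add[OF z this] show ?thesis by simp
qed

lemma char_centered_gaussian:
  assumes "0 \<le> v"
  shows "char (centered_gaussian v) s = of_real (exp (- (s\<^sup>2 * v / 2)))"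
proof -
  have "char (centered_gaussian v) s = char std_normal_distribution (s * sqrt v)"
    unfolding centered_gaussian_def char_def by (subst integral_distr) (auto simp: mult.assoc)
  also have "\<dots> = of_real (exp (- (s * sqrt v)\<^sup>2 / 2))"
    by (simp only: char_std_normal_distribution)
  also have "- (s * sqrt v)\<^sup>2 / 2 = - (s\<^sup>2 * v / 2)"
    using assms by (simp add: power_mult_distrib)
  finally show ?thesis .
qed

lemma real_distribution_centered_gaussian: "real_distribution (centered_gaussian v)"
  unfolding centered_gaussian_def by (rule std_normal.real_distribution_distr) simp

lemma integrable_ln_cosh:
  "integrable std_normal_distribution (\<lambda>y. ln (cosh (c * y + h)))"
  "integrable std_normal_distribution (\<lambda>y. (ln (cosh (c * y + h)))\<^sup>2)"
proof -
  have meas: "(\<lambda>y. ln (cosh (c * y + h))) \<in> borel_measurable std_normal_distribution"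
    by (simp add: cosh_def)
  have le: "\<bar>ln (cosh x)\<bar> \<le> \<bar>x\<bar>" for x :: real
  proof -
    have "cosh x \<le> exp \<bar>x\<bar>"
    proof -
      have *: "(exp x + exp (- x)) / 2 \<le> y" if "exp x \<le> y" "exp (- x) \<le> y" for y
        using that by simp
      show ?thesis unfolding cosh_field_def by (rule *) simp_all
    qed
    then have "ln (cosh x) \<le> ln (exp \<bar>x\<bar>)" by (subst ln_le_cancel_iff) auto
    then have "ln (cosh x) \<le> \<bar>x\<bar>" by simp
    moreover have "0 \<le> ln (cosh x)" using cosh_real_ge_1[of x] by simp
    ultimately show ?thesis by simp
  qed
  have "integrable std_normal_distribution (\<lambda>y. c\<^sup>2 * y\<^sup>2 + 2 * c * h * y ^ 1 + h\<^sup>2)"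
    by (intro Bochner_Integration.integrable_add integrable_mult_right
        integrable_std_normal_distribution_moment std_normal.integrable_const)
  then have "integrable std_normal_distribution (\<lambda>y. (c * y + h)\<^sup>2)"
    by (simp add: power2_eq_square algebra_simps)
  then show sq: "integrable std_normal_distribution (\<lambda>y. (ln (cosh (c * y + h)))\<^sup>2)"
    by (rule Bochner_Integration.integrable_bound) (use meas le in \<open>auto intro!: AE_I2 simp: abs_le_square_iff[symmetric]\<close>)
  show "integrable std_normal_distribution (\<lambda>y. ln (cosh (c * y + h)))"
    by (rule std_normal.square_integrable_imp_integrable[OF meas sq])
qed

section \<open>Marginals at time one\<close>

text \<open>A nonzero value at 1 would force the integrand to be at least c / (1 - s) in modulus
  near 1, and that integral diverges logarithmically.\<close>

lemma zero_of_set_integrable_pole: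
  fixes x :: "real \<Rightarrow> real"
  assumes cont: "continuous_on {0..1} x" and int: "set_integrable lborel {0..1} (\<lambda>s. x s / (1 - s))"
  shows "x 1 = 0"
proof (rule ccontr)
  assume "x 1 \<noteq> 0"
  define c where "c = \<bar>x 1\<bar> / 2"
  have c: "c > 0" using \<open>x 1 \<noteq> 0\<close> by (simp add: c_def)
  obtain \<delta> where \<delta>: "\<delta> > 0" "\<And>s. s \<in> {0..1} \<Longrightarrow> dist s 1 < \<delta> \<Longrightarrow> dist (x s) (x 1) < c"
    using cont c unfolding continuous_on_iff by (metis atLeastAtMost_iff order_refl zero_le_one)
  define d where "d = min (\<delta> / 2) (1 / 2)"
  have d: "0 < d" "d \<le> 1 / 2" "d < \<delta>" using \<delta>(1) by (auto simp: d_def)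
  have x_ge: "c \<le> \<bar>x s\<bar>" if "s \<in> {1 - d..1}" for s
  proof -
    have "\<bar>x s - x 1\<bar> < c" using \<delta>(2)[of s] that d by (auto simp: dist_real_def)
    then show ?thesis unfolding c_def by linarith
  qed
  define f where "f s = indicator {0..1} s * \<bar>x s / (1 - s)\<bar>" for s :: real
  have f_int: "integrable lborel f"
    using integrable_abs[OF int[unfolded set_integrable_def]] by (simp add: f_def[abs_def] abs_mult)
  define K where "K = (LINT s|lborel. f s)"
  have K: "0 \<le> K" unfolding K_def f_def by (rule Bochner_Integration.integral_nonneg) simp
  \<comment> \<open>Chosen so that the integral of c / (1 - s) from 1 - d to 1 - \<epsilon>, which
    is c ln (d / \<epsilon>), equals K + 1 and exceeds the total mass K.\<close>
  define \<epsilon> where "\<epsilon> = d * exp (- ((K + 1) / c))"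
  have \<epsilon>: "0 < \<epsilon>" "\<epsilon> \<le> d" using d c K by (auto simp: \<epsilon>_def)
  have "(LINT s|lborel. c / (1 - s) * indicator {1 - d..1 - \<epsilon>} s) = - c * ln (1 - (1 - \<epsilon>)) - (- c * ln (1 - (1 - d)))"
    and g_int: "integrable lborel (\<lambda>s. c / (1 - s) * indicator {1 - d..1 - \<epsilon>} s)"
  proof -
    have der: "((\<lambda>s. - c * ln (1 - s)) has_real_derivative c / (1 - s)) (at s)"
      and nn: "0 \<le> c / (1 - s)" if "s \<in> {1 - d..1 - \<epsilon>}" for s
      using that \<epsilon> c by (auto intro!: derivative_eq_intros simp: field_simps)
    have "1 - d \<le> 1 - \<epsilon>" and "(\<lambda>s. c / (1 - s)) \<in> borel_measurable borel" using \<epsilon> by auto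
    note * = this(2) der nn this(1)
    show "(LINT s|lborel. c / (1 - s) * indicator {1 - d..1 - \<epsilon>} s) = - c * ln (1 - (1 - \<epsilon>)) - (- c * ln (1 - (1 - d)))"
      by (rule integral_FTC_Icc_nonneg[OF *])
    show "integrable lborel (\<lambda>s. c / (1 - s) * indicator {1 - d..1 - \<epsilon>} s)"
      by (rule integrable_FTC_Icc_nonneg[OF *])
  qed
  moreover have "- c * ln (1 - (1 - \<epsilon>)) - (- c * ln (1 - (1 - d))) = K + 1"
  proof -
    have "ln \<epsilon> = ln d - (K + 1) / c" using d by (simp add: \<epsilon>_def ln_mult)
    then show ?thesis using c by (simp add: right_diff_distrib)
  qed
  moreover have "(LINT s|lborel. c / (1 - s) * indicator {1 - d..1 - \<epsilon>} s) \<le> K"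
    unfolding K_def
  proof (rule integral_mono[OF g_int f_int])
    fix s :: real
    show "c / (1 - s) * indicator {1 - d..1 - \<epsilon>} s \<le> f s"
    proof (cases "s \<in> {1 - d..1 - \<epsilon>}")
      case True
      with d \<epsilon> have s: "s \<in> {0..1}" "s < 1" "s \<in> {1 - d..1}" by auto
      show ?thesis using True s x_ge[OF s(3)] by (simp add: f_def abs_divide divide_right_mono)
    qed (simp add: f_def)
  qed
  ultimately show False by simp
qed

lemma bridge_solution_terminal:
  assumes "bridge_solution M F \<eta> W X"
  shows "AE \<omega> in M. X 1 \<omega> = 0"
proof -
  have "AE \<omega> in M. continuous_on {0..1} (\<lambda>t. X t \<omega>) \<and> set_integrable lborel {0..1} (\<lambda>s. X s \<omega> / (1 - s))"
    using assms unfolding bridge_solution_def by (auto elim!: AE_mp)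
  then show ?thesis
    by (rule AE_mp) (auto intro!: AE_I2 zero_of_set_integrable_pole)
qed

lemma stochastic_basis_measurable:
  assumes "complete_stochastic_basis M F" "t \<in> {0..1}" "f \<in> borel_measurable (F t)"
  shows "f \<in> borel_measurable M"
proof -
  have "subalgebra M (F t)" using assms(1,2) by (simp add: complete_stochastic_basis_def)
  then show ?thesis using assms(3) by (rule measurable_from_subalg)
qed

lemma brownian_motion_one:
  assumes basis: "complete_stochastic_basis M F" and W: "std_brownian_motion M F W"
  shows "W 1 \<in> borel_measurable M" "distr M borel (W 1) = std_normal_distribution"
proof -
  show meas: "W 1 \<in> borel_measurable M"
    using W by (intro stochastic_basis_measurable[OF basis, of 1]) (auto simp: std_brownian_motion_def)
  have meas0: "W 0 \<in> borel_measurable M"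
    using W by (intro stochastic_basis_measurable[OF basis, of 0]) (auto simp: std_brownian_motion_def)
  have "distributed M lborel (\<lambda>\<omega>. W 1 \<omega> - W 0 \<omega>) std_normal_density"
    using conjunct2[OF conjunct2[OF W[unfolded std_brownian_motion_def]], THEN spec[of _ 0], THEN spec[of _ 1]]
    by simp
  then have "distr M lborel (\<lambda>\<omega>. W 1 \<omega> - W 0 \<omega>) = std_normal_distribution"
    by (simp add: distributed_def)
  moreover have "distr M lborel (\<lambda>\<omega>. W 1 \<omega> - W 0 \<omega>) = distr M borel (\<lambda>\<omega>. W 1 \<omega> - W 0 \<omega>)"
    by (rule distr_cong) auto
  moreover have "distr M borel (\<lambda>\<omega>. W 1 \<omega> - W 0 \<omega>) = distr M borel (W 1)"
    by (rule distr_cong_AE) (use W meas meas0 in \<open>auto simp: std_brownian_motion_def\<close>)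
  ultimately show "distr M borel (W 1) = std_normal_distribution" by simp
qed

text \<open>The site coordinates are filled with W_i(1) so that the vector has the full standard
  Gaussian law on the index set; at the end of the rotation their weight is cos (pi / 2) =
  0.\<close>

definition terminal_values ::
    "(nat \<Rightarrow> nat \<Rightarrow> real \<Rightarrow> 'a \<Rightarrow> real) \<Rightarrow> (nat \<Rightarrow> real \<Rightarrow> 'a \<Rightarrow> real) \<Rightarrow> (nat \<times> nat) + nat \<Rightarrow> 'a \<Rightarrow> real" where
  "terminal_values B W = case_sum (\<lambda>(i, j). B i j 1) (\<lambda>i. W i 1)"

lemma terminal_values_law:
  assumes basis: "complete_stochastic_basis M F"
    and B: "\<And>i j. 1 \<le> i \<Longrightarrow> i < j \<Longrightarrow> std_brownian_motion M F (B i j)"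
    and W: "\<And>i. 1 \<le> i \<Longrightarrow> std_brownian_motion M F (W i)"
    and indep: "independent_processes M B W" and N: "1 \<le> N"
  shows "(\<lambda>\<omega>. \<lambda>k\<in>sk_index N. terminal_values B W k \<omega>) \<in> measurable M (std_gaussian (sk_index N))"
    and "distr M (std_gaussian (sk_index N)) (\<lambda>\<omega>. \<lambda>k\<in>sk_index N. terminal_values B W k \<omega>) = std_gaussian (sk_index N)"
proof -
  interpret prob_space M using basis by (simp add: complete_stochastic_basis_def)
  let ?I = "sk_index N" and ?T = "terminal_values B W"
  have ne: "?I \<noteq> {}" using N by (auto simp: sk_index_def)
  have T: "?T k \<in> borel_measurable M" "distr M borel (?T k) = std_normal_distribution" if "k \<in> ?I" for k
    using that brownian_motion_one[OF basis B] brownian_motion_one[OF basis W]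
    by (auto simp: sk_index_def pairs_def terminal_values_def)
  have "indep_vars (\<lambda>_. \<Pi>\<^sub>M t\<in>{0..1::real}. (borel :: real measure))
      (case_sum (\<lambda>(i, j) \<omega>. \<lambda>t\<in>{0..1}. B i j t \<omega>) (\<lambda>i \<omega>. \<lambda>t\<in>{0..1}. W i t \<omega>)) ?I"
    by (rule indep_vars_subset[OF indep[unfolded independent_processes_def]])
      (auto simp: sk_index_def pairs_def)
  from indep_vars_compose2[OF this, of "\<lambda>_ f. f 1" "\<lambda>_. borel"]
  have "indep_vars (\<lambda>_. borel) (\<lambda>k \<omega>. (case_sum (\<lambda>(i, j) \<omega>. \<lambda>t\<in>{0..1}. B i j t \<omega>) (\<lambda>i \<omega>. \<lambda>t\<in>{0..1}. W i t \<omega>) k \<omega>) (1::real)) ?I"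
    by simp
  also have "(\<lambda>k \<omega>. (case_sum (\<lambda>(i, j) \<omega>. \<lambda>t\<in>{0..1}. B i j t \<omega>) (\<lambda>i \<omega>. \<lambda>t\<in>{0..1}. W i t \<omega>) k \<omega>) (1::real)) = ?T"
    by (auto simp: terminal_values_def fun_eq_iff split: sum.split)
  finally have "distr M (\<Pi>\<^sub>M k\<in>?I. borel) (\<lambda>\<omega>. \<lambda>k\<in>?I. ?T k \<omega>) = (\<Pi>\<^sub>M k\<in>?I. distr M borel (?T k))"
    by (subst (asm) indep_vars_iff_distr_eq_PiM'[OF ne T(1)])
  also have "\<dots> = std_gaussian ?I" by (rule PiM_cong) (auto simp: T)
  finally show "distr M (std_gaussian ?I) (\<lambda>\<omega>. \<lambda>k\<in>?I. ?T k \<omega>) = std_gaussian ?I"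
    by (subst distr_cong[OF refl sets_std_gaussian refl])
  have "(\<lambda>\<omega>. \<lambda>k\<in>?I. ?T k \<omega>) \<in> measurable M (\<Pi>\<^sub>M k\<in>?I. borel)"
    using T by (intro measurable_restrict) auto
  then show "(\<lambda>\<omega>. \<lambda>k\<in>?I. ?T k \<omega>) \<in> measurable M (std_gaussian ?I)"
    by (simp cong: measurable_cong_sets add: sets_std_gaussian)
qed

lemma free_energy_fluctuation_measurable:
  assumes B: "\<And>i j. 1 \<le> i \<Longrightarrow> i < j \<Longrightarrow> B i j t \<in> borel_measurable M"
    and X: "\<And>i. 1 \<le> i \<Longrightarrow> X i t \<in> borel_measurable M"
  shows "free_energy_fluctuation \<beta> h q B X N t \<in> borel_measurable M"
proof -
  have [measurable]: "hamiltonian \<beta> h q B X N t \<sigma> \<in> borel_measurable M" for \<sigma>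
    unfolding hamiltonian_def[abs_def] case_prod_unfold
    by (intro borel_measurable_uminus borel_measurable_add borel_measurable_times borel_measurable_sum
        borel_measurable_const B X) auto
  show ?thesis
    unfolding free_energy_fluctuation_def[abs_def] partition_function_def by measurable
qed

section \<open>The characteristic function of the fluctuations\<close>

context sk_interpolation
begin

lemma Z_end: "Z (pi / 2) g = (\<Sum>\<sigma>\<in>\<Sigma>. exp (\<beta> / sqrt (real N) * (\<Sum>(i, j)\<in>pairs N. g (Inl (i, j)) * \<sigma> i * \<sigma> j)
    + h * (\<Sum>i=1..N. \<sigma> i)))"
proof -
  have "energy a b (pi / 2) g \<sigma> = \<beta> / sqrt (real N) * (\<Sum>(i, j)\<in>pairs N. g (Inl (i, j)) * \<sigma> i * \<sigma> j)
      + h * (\<Sum>i=1..N. \<sigma> i)" for \<sigma>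
    unfolding energy_def unfolding sk_index_def sk_field_def sum_distrib_left[of "\<beta> / sqrt (real N)"]
    by (subst sum.Plus) (auto simp: finite_pairs trig_def sk_coeff_def intro!: sum.cong)
  then show ?thesis by (simp add: Z_def)
qed

text \<open>The bridges vanish at time 1, so almost surely the partition function is
  \<open>Z (pi / 2)\<close> evaluated at a standard Gaussian vector; the deterministic centering
  only contributes a phase.\<close>

lemma char_fluctuation:
  fixes M :: "'a measure" and s :: real
  assumes basis: "complete_stochastic_basis M F"
    and B: "\<And>i j. 1 \<le> i \<Longrightarrow> i < j \<Longrightarrow> std_brownian_motion M F (B i j)"
    and W: "\<And>i. 1 \<le> i \<Longrightarrow> std_brownian_motion M F (W i)"
    and indep: "independent_processes M B W"
    and \<xi>: "\<And>i. 1 \<le> i \<Longrightarrow> bridge_solution M F (\<eta> i) (W i) (\<xi> i)"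
    and meas: "free_energy_fluctuation \<beta> h q B \<xi> N 1 \<in> borel_measurable M"
  defines "L \<equiv> LINT y|std_normal_distribution. ln (cosh (site y))"
    and "u \<equiv> s / sqrt (real N)"
  shows "char (distr M borel (free_energy_fluctuation \<beta> h q B \<xi> N 1)) s
    = iexp (- u * real N * (ln 2 + \<beta>\<^sup>2 * (1 - q)\<^sup>2 / 4 + L)) * char_log_Z u (pi / 2)"
proof -
  let ?T = "\<lambda>\<omega>. \<lambda>k\<in>I. terminal_values B W k \<omega>"
  have law: "distr M (std_gaussian I) ?T = std_gaussian I"
    by (rule terminal_values_law(2)[OF basis B W indep N_pos])
  have "AE \<omega> in M. \<forall>i\<in>{1..N}. \<xi> i 1 \<omega> = 0"
    by (rule AE_finite_allI) (auto intro: bridge_solution_terminal[OF \<xi>])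
  then have AE: "AE \<omega> in M. partition_function \<beta> h q B \<xi> N 1 \<omega> = Z (pi / 2) (?T \<omega>)"
  proof (rule AE_mp, intro AE_I2 impI)
    fix \<omega> assume 0: "\<forall>i\<in>{1..N}. \<xi> i 1 \<omega> = 0"
    show "partition_function \<beta> h q B \<xi> N 1 \<omega> = Z (pi / 2) (?T \<omega>)"
      unfolding partition_function_def Z_end hamiltonian_def pairs_def[symmetric]
      using 0 by (intro sum.cong refl arg_cong[where f=exp])
        (auto simp: terminal_values_def sk_index_def intro!: sum.cong)
  qed
  have Y: "s * free_energy_fluctuation \<beta> h q B \<xi> N 1 \<omega>
      = - u * real N * (ln 2 + \<beta>\<^sup>2 * (1 - q)\<^sup>2 / 4 + L) + u * ln (partition_function \<beta> h q B \<xi> N 1 \<omega>)" for \<omega>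
  proof -
    have "s = u * sqrt N" using N_pos by (simp add: u_def)
    moreover have "sqrt N * sqrt N = real N" by simp
    ultimately have "s * sqrt N = u * real N" by (metis mult.assoc)
    then have "s * free_energy_fluctuation \<beta> h q B \<xi> N 1 \<omega> = u * real N *
       (ln (partition_function \<beta> h q B \<xi> N 1 \<omega>) / real N - ln 2 - \<beta>\<^sup>2 * 1 * (1 - q)\<^sup>2 / 4 - L)"
      unfolding free_energy_fluctuation_def L_def mult.assoc[symmetric] by simp
    then show ?thesis using N_pos by (simp add: algebra_simps)
  qed
  have "char (distr M borel (free_energy_fluctuation \<beta> h q B \<xi> N 1)) s
      = (CLINT \<omega>|M. iexp (s * free_energy_fluctuation \<beta> h q B \<xi> N 1 \<omega>))"
    unfolding char_def using meas by (subst integral_distr) auto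
  also have "\<dots> = (CLINT \<omega>|M. iexp (- u * real N * (ln 2 + \<beta>\<^sup>2 * (1 - q)\<^sup>2 / 4 + L))
      * iexp (u * ln (Z (pi / 2) (?T \<omega>))))"
  proof (rule integral_cong_AE)
    have Tm: "?T \<in> measurable M (std_gaussian I)" by (rule terminal_values_law[OF basis B W indep N_pos])
    have Zm: "Z (pi / 2) \<in> borel_measurable (std_gaussian I)" unfolding Z_def[abs_def] energy_def by measurable
    have [measurable]: "(\<lambda>\<omega>. Z (pi / 2) (?T \<omega>)) \<in> borel_measurable M" by (rule measurable_compose[OF Tm Zm])
    show "(\<lambda>\<omega>. iexp (- u * real N * (ln 2 + \<beta>\<^sup>2 * (1 - q)\<^sup>2 / 4 + L)) * iexp (u * ln (Z (pi / 2) (?T \<omega>))))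
        \<in> borel_measurable M" by measurable
    show "(\<lambda>\<omega>. iexp (s * free_energy_fluctuation \<beta> h q B \<xi> N 1 \<omega>)) \<in> borel_measurable M"
      using meas by measurable
    show "AE \<omega> in M. iexp (s * free_energy_fluctuation \<beta> h q B \<xi> N 1 \<omega>)
      = iexp (- u * real N * (ln 2 + \<beta>\<^sup>2 * (1 - q)\<^sup>2 / 4 + L)) * iexp (u * ln (Z (pi / 2) (?T \<omega>)))"
      using AE by (rule AE_mp) (auto intro!: AE_I2 simp only: Y exp_add[symmetric] of_real_add distrib_left)
  qed
  also have "\<dots> = iexp (- u * real N * (ln 2 + \<beta>\<^sup>2 * (1 - q)\<^sup>2 / 4 + L)) * (CLINT \<omega>|M. iexp (u * ln (Z (pi / 2) (?T \<omega>))))"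
    by (rule integral_mult_right_zero)
  also have "(CLINT \<omega>|M. iexp (u * ln (Z (pi / 2) (?T \<omega>))))
      = (CLINT g|distr M (std_gaussian I) ?T. iexp (u * ln (Z (pi / 2) g)))"
  proof (rule integral_distr[symmetric])
    show "?T \<in> measurable M (std_gaussian I)" by (rule terminal_values_law[OF basis B W indep N_pos])
    show "(\<lambda>g. iexp (u * ln (Z (pi / 2) g))) \<in> borel_measurable (std_gaussian I)"
      unfolding Z_def energy_def by measurable
  qed
  also have "\<dots> = char_log_Z u (pi / 2)"
    unfolding law char_log_Z_def ..
  finally show ?thesis .
qed

text \<open>The imaginary part of the drift matches the centering \<beta>^2 (1 - q)^2 / 4; what
  remains, ln 2 + L per site, is the unimodular factor \<open>P\<close>. Multiplying the endpoint
  estimate by \<open>P\<close> turns its value at time 0 into the Nth power of the characteristic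
  function of one centered site.\<close>

lemma char_fluctuation_approx:
  fixes M :: "'a measure" and s :: real
  assumes basis: "complete_stochastic_basis M F"
    and B: "\<And>i j. 1 \<le> i \<Longrightarrow> i < j \<Longrightarrow> std_brownian_motion M F (B i j)"
    and W: "\<And>i. 1 \<le> i \<Longrightarrow> std_brownian_motion M F (W i)"
    and indep: "independent_processes M B W"
    and \<xi>: "\<And>i. 1 \<le> i \<Longrightarrow> bridge_solution M F (\<eta> i) (W i) (\<xi> i)"
    and meas: "free_energy_fluctuation \<beta> h q B \<xi> N 1 \<in> borel_measurable M"
  defines "L \<equiv> LINT y|std_normal_distribution. ln (cosh (site y))"
    and "u \<equiv> s / sqrt (real N)"
  shows "norm (char (distr M borel (free_energy_fluctuation \<beta> h q B \<xi> N 1)) s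
        * of_real (exp (- (\<beta>\<^sup>2 * s\<^sup>2 * (q\<^sup>2 + 1 / real N) / 4)))
      - char (distr std_normal_distribution borel (\<lambda>y. ln (cosh (site y)) - L)) u ^ N)
    \<le> 16 * (\<bar>u\<bar> * (1 + \<bar>u\<bar>))"
proof -
  define P where "P = iexp (- u * real N * (ln 2 + L))"
  have nP: "norm P = 1" unfolding P_def norm_exp_i_times ..
  have u2: "u\<^sup>2 * (real N * q\<^sup>2 + 1) = s\<^sup>2 * (q\<^sup>2 + 1 / real N)"
    using N_pos by (simp add: u_def power_divide field_simps)
  have "char (distr M borel (free_energy_fluctuation \<beta> h q B \<xi> N 1)) s
        * of_real (exp (- (\<beta>\<^sup>2 * s\<^sup>2 * (q\<^sup>2 + 1 / real N) / 4)))
      = P * (char_log_Z u (pi / 2) * exp (- (\<beta>\<^sup>2 / 2) * drift u))"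
  proof -
    have cf: "char (distr M borel (free_energy_fluctuation \<beta> h q B \<xi> N 1)) s
      = iexp (- u * real N * (ln 2 + \<beta>\<^sup>2 * (1 - q)\<^sup>2 / 4 + L)) * char_log_Z u (pi / 2)"
      unfolding u_def L_def by (rule char_fluctuation[OF basis B W indep \<xi> meas])
    have "(- (\<beta>\<^sup>2 / 2) * drift u) = \<i> * of_real (- u * real N * (\<beta>\<^sup>2 * (1 - q)\<^sup>2 / 4))
        + of_real (- (\<beta>\<^sup>2 * (u\<^sup>2 * (real N * q\<^sup>2 + 1)) / 4))"
      by (simp add: drift_def field_simps)
    then have "iexp (- u * real N * (ln 2 + L)) * exp (- (\<beta>\<^sup>2 / 2) * drift u)
       = exp (\<i> * of_real (- u * real N * (ln 2 + L)) + (\<i> * of_real (- u * real N * (\<beta>\<^sup>2 * (1 - q)\<^sup>2 / 4))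
        + of_real (- (\<beta>\<^sup>2 * (u\<^sup>2 * (real N * q\<^sup>2 + 1)) / 4))))"
      by (simp only: exp_add)
    also have "\<dots> = exp (\<i> * of_real (- u * real N * (ln 2 + \<beta>\<^sup>2 * (1 - q)\<^sup>2 / 4 + L))
        + of_real (- (\<beta>\<^sup>2 * (u\<^sup>2 * (real N * q\<^sup>2 + 1)) / 4)))"
      by (rule arg_cong[where f=exp]) (simp add: algebra_simps)
    also have "\<dots> = iexp (- u * real N * (ln 2 + \<beta>\<^sup>2 * (1 - q)\<^sup>2 / 4 + L))
        * of_real (exp (- (\<beta>\<^sup>2 * s\<^sup>2 * (q\<^sup>2 + 1 / real N) / 4)))"
      unfolding exp_add u2 exp_of_real mult.assoc ..
    finally show ?thesis
      unfolding cf P_def by (simp only: mult_ac)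
  qed
  moreover have "char (distr std_normal_distribution borel (\<lambda>y. ln (cosh (site y)) - L)) u ^ N = P * char_log_Z u 0"
  proof -
    have "char (distr std_normal_distribution borel (\<lambda>y. ln (cosh (site y)) - L)) u
        = (CLINT y|std_normal_distribution. iexp (u * (ln (cosh (site y)) - L)))"
      unfolding char_def by (subst integral_distr) (auto simp: cosh_def)
    also have "\<dots> = (CLINT y|std_normal_distribution. iexp (- u * (ln 2 + L)) * iexp (u * ln (2 * cosh (site y))))"
      unfolding exp_add[symmetric]
      by (intro Bochner_Integration.integral_cong refl arg_cong[where f=exp]) (simp add: ln_mult algebra_simps)
    also have "\<dots> = iexp (- u * (ln 2 + L)) * (CLINT y|std_normal_distribution. iexp (u * ln (2 * cosh (site y))))"
      by (rule integral_mult_right_zero)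
    finally have "char (distr std_normal_distribution borel (\<lambda>y. ln (cosh (site y)) - L)) u
        = iexp (- u * (ln 2 + L)) * (CLINT y|std_normal_distribution. iexp (u * ln (2 * cosh (site y))))" .
    moreover have "iexp (- u * (ln 2 + L)) ^ N = P"
      unfolding P_def exp_of_nat_mult[symmetric] by (rule arg_cong[where f=exp]) simp
    ultimately show ?thesis by (simp add: char_log_Z_zero power_mult_distrib)
  qed
  ultimately have "norm (char (distr M borel (free_energy_fluctuation \<beta> h q B \<xi> N 1)) s
        * of_real (exp (- (\<beta>\<^sup>2 * s\<^sup>2 * (q\<^sup>2 + 1 / real N) / 4)))
      - char (distr std_normal_distribution borel (\<lambda>y. ln (cosh (site y)) - L)) u ^ N)
    = norm (P * (char_log_Z u (pi / 2) * exp (- (\<beta>\<^sup>2 / 2) * drift u) - char_log_Z u 0))"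
    by (simp only: right_diff_distrib)
  also have "\<dots> \<le> 16 * (\<bar>u\<bar> * (1 + \<bar>u\<bar>))"
    using char_log_Z_endpoints[of u] by (simp only: norm_mult[of P] nP mult_1_left)
  finally show ?thesis .
qed

end

section \<open>Convergence in distribution for small inverse temperature\<close>

lemma sk_interpolationI:
  assumes "16 * sqrt 2 * \<beta>\<^sub>0 * exp (16 * \<beta>\<^sub>0\<^sup>2) = 1" "0 < \<beta>" "\<beta> < \<beta>\<^sub>0" "0 \<le> q" "q \<le> 1"
    "q = (LINT y|std_normal_distribution. (tanh (\<beta> * sqrt q * y + h))\<^sup>2)" "1 \<le> N"
  shows "sk_interpolation \<beta> h q N"
proof
  \<comment> \<open>Both sqrt 2 and the exponential are at least 1, so the defining equation gives
    \<open>16 * \<beta>\<^sub>0 \<le> 1\<close>.\<close>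
  have "16 * 1 * \<beta>\<^sub>0 * 1 \<le> 16 * sqrt 2 * \<beta>\<^sub>0 * exp (16 * \<beta>\<^sub>0\<^sup>2)"
    using assms by (intro mult_mono) auto
  then show "\<beta> \<le> 1 / 4" using assms by simp
qed (use assms in auto)

theorem theorem2p6:
  fixes M :: "'a measure" and F :: "real \<Rightarrow> 'a measure"
    and B :: "nat \<Rightarrow> nat \<Rightarrow> real \<Rightarrow> 'a \<Rightarrow> real"
    and W X :: "nat \<Rightarrow> real \<Rightarrow> 'a \<Rightarrow> real"
    and \<eta> :: "nat \<Rightarrow> 'a \<Rightarrow> real"
    and \<beta> \<beta>\<^sub>0 h q :: real
  assumes basis: "complete_stochastic_basis M F"
    and B_brownian: "\<And>i j. 1 \<le> i \<Longrightarrow> i < j \<Longrightarrow> std_brownian_motion M F (B i j)"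
    and W_brownian: "\<And>i. 1 \<le> i \<Longrightarrow> std_brownian_motion M F (W i)"
    and BW_indep: "independent_processes M B W"
    and \<eta>_measurable: "\<And>i. 1 \<le> i \<Longrightarrow> \<eta> i \<in> borel_measurable (F 0)"
    and \<eta>_normal: "\<And>i. 1 \<le> i \<Longrightarrow> distributed M lborel (\<eta> i) std_normal_density"
    and \<eta>_indep: "prob_space.indep_vars M (\<lambda>_. borel) \<eta> {1..}"
    and X_solution: "\<And>i. 1 \<le> i \<Longrightarrow> bridge_solution M F (\<eta> i) (W i) (X i)"
    and \<beta>\<^sub>0_pos: "\<beta>\<^sub>0 > 0"
    and \<beta>\<^sub>0_eq: "16 * sqrt 2 * \<beta>\<^sub>0 * exp (16 * \<beta>\<^sub>0\<^sup>2) = 1"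
    and h_pos: "h > 0"
    and \<beta>_pos: "\<beta> > 0"
    and \<beta>_less: "\<beta> < \<beta>\<^sub>0"
    and q_range: "0 \<le> q" "q \<le> 1"
    and q_eq: "q = (LINT y|std_normal_distribution. (tanh (\<beta> * sqrt q * y + h))\<^sup>2)"
  shows "0 \<le> limit_variance \<beta> h q \<and>
    weak_conv_m (\<lambda>N. distr M borel (free_energy_fluctuation \<beta> h q B X N 1))
      (centered_gaussian (limit_variance \<beta> h q))"
proof -
  interpret prob_space M using basis by (simp add: complete_stochastic_basis_def)
  let ?Y = "\<lambda>N. free_energy_fluctuation \<beta> h q B X N 1"
  define L where "L = (LINT y|std_normal_distribution. ln (cosh (\<beta> * sqrt q * y + h)))"
  define v where "v = (LINT y|std_normal_distribution. (ln (cosh (\<beta> * sqrt q * y + h)) - L)\<^sup>2)"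
  define \<mu> where "\<mu> = distr std_normal_distribution borel (\<lambda>y. ln (cosh (\<beta> * sqrt q * y + h)) - L)"
  have \<tau>: "limit_variance \<beta> h q = v - \<beta>\<^sup>2 * q\<^sup>2 / 2"
    by (simp add: limit_variance_def v_def L_def)
  have meas: "?Y N \<in> borel_measurable M" for N
  proof (rule free_energy_fluctuation_measurable)
    show "B i j 1 \<in> borel_measurable M" if "1 \<le> i" "i < j" for i j
      by (rule brownian_motion_one[OF basis B_brownian[OF that]])
    show "X i 1 \<in> borel_measurable M" if "1 \<le> i" for i
    proof (rule stochastic_basis_measurable[OF basis])
      show "X i 1 \<in> borel_measurable (F 1)"
        using conjunct1[OF X_solution[OF that, unfolded bridge_solution_def]] by simp
    qed simp
  qed
  have rv [measurable]: "(\<lambda>y. ln (cosh (\<beta> * sqrt q * y + h)) - L) \<in> borel_measurable std_normal_distribution"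
    by (simp add: cosh_def)
  note int = integrable_ln_cosh[of "\<beta> * sqrt q" h]
  have int_L: "integrable std_normal_distribution (\<lambda>y. ln (cosh (\<beta> * sqrt q * y + h)) - L)"
    using int(1) by simp
  have "integrable std_normal_distribution
      (\<lambda>y. (ln (cosh (\<beta> * sqrt q * y + h)))\<^sup>2 - 2 * L * ln (cosh (\<beta> * sqrt q * y + h)) + L\<^sup>2)"
    using int by simp
  then have int_L2: "integrable std_normal_distribution (\<lambda>y. (ln (cosh (\<beta> * sqrt q * y + h)) - L)\<^sup>2)"
    by (simp add: power2_eq_square algebra_simps)
  have mean0: "(LINT y|std_normal_distribution. ln (cosh (\<beta> * sqrt q * y + h)) - L) = 0"
    using int(1) std_normal.prob_space by (simp add: L_def[symmetric])
  interpret \<mu>: real_distribution \<mu>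
    unfolding \<mu>_def by (rule std_normal.real_distribution_distr) (rule rv)
  have \<mu>_mean: "\<mu>.expectation (\<lambda>x. x) = 0"
    unfolding \<mu>_def using mean0 by (subst integral_distr) auto
  have \<mu>_lim: "(\<lambda>N. char \<mu> (s / sqrt (real N)) ^ N) \<longlonglongrightarrow> of_real (exp (- (s\<^sup>2 * v / 2)))" for s
  proof (rule \<mu>.char_power_limit[OF _ \<mu>_mean])
    show "integrable \<mu> (\<lambda>x. x)" "integrable \<mu> (\<lambda>x. x\<^sup>2)"
      unfolding \<mu>_def using int_L int_L2 by (simp_all add: integrable_distr_eq)
    have "\<mu>.expectation (\<lambda>x. x\<^sup>2) = v"
      unfolding \<mu>_def v_def by (subst integral_distr) auto
    then show "\<mu>.variance (\<lambda>x. x) = v" by (simp add: \<mu>_mean)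
  qed
  have lim: "(\<lambda>N. char (distr M borel (?Y N)) s) \<longlonglongrightarrow> of_real (exp (- (s\<^sup>2 * limit_variance \<beta> h q / 2)))" for s
  proof -
    define e where "e N = exp (- (\<beta>\<^sup>2 * s\<^sup>2 * (q\<^sup>2 + 1 / real N) / 4))" for N
    define u where "u N = \<bar>s / sqrt (real N)\<bar>" for N
    have u_lim: "u \<longlonglongrightarrow> 0"
    proof -
      have "(\<lambda>N. 1 / sqrt (real N)) \<longlonglongrightarrow> 0" by real_asymp
      from tendsto_mult_right_zero[OF this, of "\<bar>s\<bar>"] show ?thesis
        by (simp add: u_def[abs_def] abs_divide)
    qed
    have "(\<lambda>N. 16 * (u N * (1 + u N))) \<longlonglongrightarrow> 16 * (0 * (1 + 0))"
      by (intro tendsto_intros u_lim)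
    then have bound_lim: "(\<lambda>N. 16 * (u N * (1 + u N))) \<longlonglongrightarrow> 0" by simp
    have "\<forall>\<^sub>F N in sequentially. norm (char (distr M borel (?Y N)) s * of_real (e N)
        - char \<mu> (s / sqrt (real N)) ^ N) \<le> 16 * (u N * (1 + u N))"
    proof (rule eventually_sequentiallyI)
      fix N :: nat assume N: "1 \<le> N"
      interpret sk: sk_interpolation \<beta> h q N
        by (rule sk_interpolationI[OF \<beta>\<^sub>0_eq \<beta>_pos \<beta>_less q_range q_eq N])
      show "norm (char (distr M borel (?Y N)) s * of_real (e N)
          - char \<mu> (s / sqrt (real N)) ^ N) \<le> 16 * (u N * (1 + u N))"
        unfolding e_def u_def \<mu>_def L_def
        by (rule sk.char_fluctuation_approx[OF basis B_brownian W_brownian BW_indep X_solution meas])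
    qed
    from Lim_null_comparison[OF this bound_lim]
    have "(\<lambda>N. char (distr M borel (?Y N)) s * of_real (e N)
        - char \<mu> (s / sqrt (real N)) ^ N) \<longlonglongrightarrow> 0" .
    from tendsto_add[OF this \<mu>_lim[of s]]
    have "(\<lambda>N. char (distr M borel (?Y N)) s * of_real (e N)) \<longlonglongrightarrow> of_real (exp (- (s\<^sup>2 * v / 2)))"
      by simp
    moreover have "(\<lambda>N. complex_of_real (e N)) \<longlonglongrightarrow> of_real (exp (- (\<beta>\<^sup>2 * s\<^sup>2 * (q\<^sup>2 + 0) / 4)))"
      unfolding e_def by (intro tendsto_intros lim_1_over_n) simp
    \<comment> \<open>Dividing by \<open>e N\<close>, whose limit is positive, moves \<beta>^2 q^2 /
      2 into the variance with a negative sign.\<close>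
    ultimately have "(\<lambda>N. char (distr M borel (?Y N)) s * of_real (e N) / of_real (e N))
        \<longlonglongrightarrow> of_real (exp (- (s\<^sup>2 * v / 2))) / of_real (exp (- (\<beta>\<^sup>2 * s\<^sup>2 * (q\<^sup>2 + 0) / 4)))"
      by (rule tendsto_divide) simp
    moreover have "exp (- (s\<^sup>2 * v / 2)) / exp (- (\<beta>\<^sup>2 * s\<^sup>2 * (q\<^sup>2 + 0) / 4)) = exp (- (s\<^sup>2 * limit_variance \<beta> h q / 2))"
      unfolding exp_diff[symmetric] \<tau> by (simp add: field_simps)
    ultimately show ?thesis by (simp add: e_def of_real_divide[symmetric] del: of_real_divide)
  qed
  have rd: "real_distribution (distr M borel (?Y N))" for N
    by (rule real_distribution_distr[OF meas])
  \<comment> \<open>Nonnegativity is read off the limit: characteristic functions have modulus at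
    most 1, so at s = 1 the limit exp (- \<tau>^2 / 2) is at most 1. It is then used to identify the
    limit as the characteristic function of \<open>centered_gaussian\<close>.\<close>
  have nonneg: "0 \<le> limit_variance \<beta> h q"
  proof -
    have "norm (complex_of_real (exp (- (1\<^sup>2 * limit_variance \<beta> h q / 2)))) \<le> 1"
      by (rule LIMSEQ_le_const2[OF tendsto_norm[OF lim[of 1]]])
        (intro exI allI impI real_distribution.cmod_char_le_1[OF rd])
    then show ?thesis by simp
  qed
  moreover have "weak_conv_m (\<lambda>N. distr M borel (?Y N)) (centered_gaussian (limit_variance \<beta> h q))"
    by (rule levy_continuity[OF rd real_distribution_centered_gaussian])
      (simp only: char_centered_gaussian[OF nonneg] lim)
  ultimately show ?thesis ..
qed


end
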